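(* Let $N = (G, u, b, \tau, T)$ be an undirected network over time in which $B$ units of flow can be sent within the time horizon $T$. Then there exists an orientation of $N$ in which at least $B/3$ units of flow can be sent within time horizon $T$.
   Context: An undirected network over time $N = (G, u, b, \tau, T)$ consists of an undirected graph $G$ (parallel edges allowed), capacities $u_e \geq 0$ (maximal inflow rates) and transit times $\tau_e \geq 0$ on the edges $e \in E(G)$, balances $b_v$ on the nodes with $\sum_{v} b_v = 0$, and a time horizon $T \geq 0$. Nodes with $b_v > 0$ are sources (with supply $b_v$), nodes with $b_v < 0$ are sinks (with demand $-b_v$), and $B := \sum_{v: b_v > 0} b_v$ is the total supply. A flow over time assigns Lebesgue-integrable flow rate functions $f_e:[0,T)\to\mathbb{R}_{\geq 0}$ to the edges, respecting capacities $f_e(\theta) \le u_e$, with flow entering edge $e$ at time $\theta$ leaving it at time $\theta+\tau_e$, no flow left on edges after $T$, and flow conservation at all times: intermediate nodes have nonnegative excess at all times and zero excess at time $T$; a source $v$ sends out at most $b_v$ in total; a sink $v$ receives at most $-b_v$ in total. Its value is the total amount of flow that has reached the sinks by time $T$. In the undirected network, each edge may be used by flow in both directions, with the capacity of the edge shared between both directions. An orientation of $N$ is the directed network over time obtained by replacing each undirected edge $\{v,w\}$ by exactly one of the directed edges $(v,w)$ or $(w,v)$ with the same capacity and transit time, keeping balances and time horizon unchanged; flow may then only use each edge in its assigned direction. *)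

theory Defs
  imports "HOL-Analysis.Analysis" "Graph_Theory.Digraph"
begin

text \<open>
  A finite undirected multigraph is given by its nodes \<open>V\<close>, its edge names \<open>E\<close> and a map
  \<open>ends\<close> sending each edge name to its two-element set of end nodes.  Sources are the nodes
  with \<open>b v > 0\<close>, sinks those with \<open>b v < 0\<close>.
\<close>

locale undirected_network_over_time =
  fixes V :: "'v set"
    and E :: "'e set"
    and ends :: "'e \<Rightarrow> 'v set"
    and u :: "'e \<Rightarrow> real"
    and b :: "'v \<Rightarrow> real"
    and \<tau> :: "'e \<Rightarrow> real"
    and T :: real
  assumes finite_nodes: "finite V"
    and finite_edges: "finite E"
    and ends_subset: "e \<in> E \<Longrightarrow> ends e \<subseteq> V"
    and card_ends: "e \<in> E \<Longrightarrow> card (ends e) = 2"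
    and capacity_nonneg: "e \<in> E \<Longrightarrow> 0 \<le> u e"
    and transit_nonneg: "e \<in> E \<Longrightarrow> 0 \<le> \<tau> e"
    and horizon_nonneg: "0 \<le> T"
    and balances_sum: "(\<Sum>v\<in>V. b v) = 0"

definition total_supply :: "'v set \<Rightarrow> ('v \<Rightarrow> real) \<Rightarrow> real" where
  "total_supply V b = (\<Sum>v\<in>{v \<in> V. b v > 0}. b v)"

text \<open>
  Net amount of flow that has reached \<open>v\<close> by time \<open>\<theta>\<close>.  Only the values of the rates on
  \<open>[0, T)\<close> matter when \<open>\<theta> \<le> T\<close>; the interval \<open>{0..<\<theta> - \<tau> a}\<close> is empty if nothing can have
  traversed \<open>a\<close> yet.
\<close>

definition excess ::
  "('v, 'a) pre_digraph \<Rightarrow> ('a \<Rightarrow> real) \<Rightarrow> ('a \<Rightarrow> real \<Rightarrow> real) \<Rightarrow> 'v \<Rightarrow> real \<Rightarrow> real" where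
  "excess D \<tau> f v \<theta> =
     (\<Sum>a\<in>in_arcs D v. LINT \<xi>:{0..<\<theta> - \<tau> a}|lebesgue. f a \<xi>) -
     (\<Sum>a\<in>out_arcs D v. LINT \<xi>:{0..<\<theta>}|lebesgue. f a \<xi>)"

text \<open>
  Everything required of a flow over time except for the capacity constraints, which differ
  between directed and undirected networks.
\<close>

definition conserving_flow_over_time ::
  "('v, 'a) pre_digraph \<Rightarrow> ('v \<Rightarrow> real) \<Rightarrow> ('a \<Rightarrow> real) \<Rightarrow> real \<Rightarrow> ('a \<Rightarrow> real \<Rightarrow> real) \<Rightarrow> bool" where
  "conserving_flow_over_time D b \<tau> T f \<longleftrightarrow>
     (\<forall>a\<in>arcs D. set_integrable lebesgue {0..<T} (f a)) \<and>
     (\<forall>a\<in>arcs D. \<forall>\<theta>\<in>{0..<T}. 0 \<le> f a \<theta>) \<and>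
     (\<forall>a\<in>arcs D. \<forall>\<theta>\<in>{0..<T}. T - \<tau> a \<le> \<theta> \<longrightarrow> f a \<theta> = 0) \<and>
     (\<forall>v\<in>verts D. b v = 0 \<longrightarrow>
        (\<forall>\<theta>\<in>{0..T}. 0 \<le> excess D \<tau> f v \<theta>) \<and> excess D \<tau> f v T = 0) \<and>
     (\<forall>v\<in>verts D. b v > 0 \<longrightarrow>
        (\<forall>\<theta>\<in>{0..T}. - b v \<le> excess D \<tau> f v \<theta> \<and> excess D \<tau> f v \<theta> \<le> 0)) \<and>
     (\<forall>v\<in>verts D. b v < 0 \<longrightarrow>
        (\<forall>\<theta>\<in>{0..T}. 0 \<le> excess D \<tau> f v \<theta> \<and> excess D \<tau> f v \<theta> \<le> - b v))"

definition flow_value ::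
  "('v, 'a) pre_digraph \<Rightarrow> ('v \<Rightarrow> real) \<Rightarrow> ('a \<Rightarrow> real) \<Rightarrow> real \<Rightarrow> ('a \<Rightarrow> real \<Rightarrow> real) \<Rightarrow> real" where
  "flow_value D b \<tau> T f = (\<Sum>v\<in>{v \<in> verts D. b v < 0}. excess D \<tau> f v T)"

definition flow_over_time ::
  "('v, 'a) pre_digraph \<Rightarrow> ('a \<Rightarrow> real) \<Rightarrow> ('v \<Rightarrow> real) \<Rightarrow> ('a \<Rightarrow> real) \<Rightarrow> real \<Rightarrow>
     ('a \<Rightarrow> real \<Rightarrow> real) \<Rightarrow> bool" where
  "flow_over_time D u b \<tau> T f \<longleftrightarrow>
     conserving_flow_over_time D b \<tau> T f \<and>
     (\<forall>a\<in>arcs D. \<forall>\<theta>\<in>{0..<T}. f a \<theta> \<le> u a)"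

text \<open>
  In an undirected network both directions of every edge may be used: the arc \<open>(e, v, w)\<close>
  traverses the edge \<open>e\<close> from \<open>v\<close> to \<open>w\<close>.
\<close>

definition bidirected :: "'v set \<Rightarrow> 'e set \<Rightarrow> ('e \<Rightarrow> 'v set) \<Rightarrow> ('v, 'e \<times> 'v \<times> 'v) pre_digraph" where
  "bidirected V E ends =
     \<lparr> verts = V,
       arcs = {(e, v, w). e \<in> E \<and> ends e = {v, w}},
       tail = (\<lambda>(e, v, w). v),
       head = (\<lambda>(e, v, w). w) \<rparr>"

text \<open>The inflow rates of the two directions of an edge share its capacity.\<close>

definition undirected_flow_over_time ::
  "'v set \<Rightarrow> 'e set \<Rightarrow> ('e \<Rightarrow> 'v set) \<Rightarrow> ('e \<Rightarrow> real) \<Rightarrow> ('v \<Rightarrow> real) \<Rightarrow> ('e \<Rightarrow> real) \<Rightarrow> real \<Rightarrow>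
     ('e \<times> 'v \<times> 'v \<Rightarrow> real \<Rightarrow> real) \<Rightarrow> bool" where
  "undirected_flow_over_time V E ends u b \<tau> T f \<longleftrightarrow>
     conserving_flow_over_time (bidirected V E ends) b (\<lambda>(e, v, w). \<tau> e) T f \<and>
     (\<forall>e\<in>E. \<forall>v w. ends e = {v, w} \<longrightarrow>
        (\<forall>\<theta>\<in>{0..<T}. f (e, v, w) \<theta> + f (e, w, v) \<theta> \<le> u e))"

definition undirected_flow_value ::
  "'v set \<Rightarrow> 'e set \<Rightarrow> ('e \<Rightarrow> 'v set) \<Rightarrow> ('v \<Rightarrow> real) \<Rightarrow> ('e \<Rightarrow> real) \<Rightarrow> real \<Rightarrow>
     ('e \<times> 'v \<times> 'v \<Rightarrow> real \<Rightarrow> real) \<Rightarrow> real" where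
  "undirected_flow_value V E ends b \<tau> T f =
     flow_value (bidirected V E ends) b (\<lambda>(e, v, w). \<tau> e) T f"

text \<open>
  An orientation keeps nodes and edge names, so capacities, transit times and balances carry
  over unchanged.
\<close>

definition orientation :: "'v set \<Rightarrow> 'e set \<Rightarrow> ('e \<Rightarrow> 'v set) \<Rightarrow> ('v, 'e) pre_digraph \<Rightarrow> bool" where
  "orientation V E ends D \<longleftrightarrow>
     verts D = V \<and> arcs D = E \<and> (\<forall>e\<in>E. {tail D e, head D e} = ends e)"

end

theory Submission
  imports Defs "Graph_Theory.Shortest_Path"
begin

text \<open>
  Let \<open>x\<close> be rates on the source-sink paths, \<open>l\<close> prices on the edges and \<open>m\<close> prices on the
  terminals.  Sending at rate \<open>x P\<close> into the path \<open>P\<close> during \<open>[0, T - \<tau>(P))\<close> gives a flow over time.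
  Kuhn's lemma yields an equilibrium: edges with \<open>l e > 0\<close> are saturated, terminals with \<open>m v > 0\<close>
  exhaust their balance, and always \<open>T - \<tau>(P) \<le> price(P)\<close> with equality if \<open>x P > 0\<close>.  The terminal
  prices are additive, so if two used paths traversed an edge in opposite directions, exchanging
  their ends would give a pair of walks that is too cheap; hence the used paths define an
  orientation.  (Transit times are first increased by some \<open>\<epsilon> > 0\<close> so that this also works for edges
  of transit time 0.)

  The value of the resulting flow is at least the total supply of the sources with \<open>m v > 0\<close>, at
  least the total demand of the sinks with \<open>m v > 0\<close>, and at least \<open>\<Sum>e. l e * u e\<close>.  The last sum is
  the capacity of the moving cut given by the distances, with respect to \<open>\<tau> + l\<close>, from the
  sources with \<open>m v = 0\<close>, so it bounds what the undirected flow sends from these sources to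
  the sinks with \<open>m v = 0\<close>.  The three bounds add up to at least the total supply.
\<close>

section \<open>Complementarity problems on a box\<close>

text \<open>This is the variational inequality on the cube \<open>[0, M]^I\<close>: the sum of
  \<open>G z i * (y i - z i)\<close> over \<open>I\<close> is at most 0 for every \<open>y\<close>
  in the cube.\<close>

definition box_solution :: "'i set \<Rightarrow> real \<Rightarrow> (('i \<Rightarrow> real) \<Rightarrow> 'i \<Rightarrow> real) \<Rightarrow> ('i \<Rightarrow> real) \<Rightarrow> bool" where
  "box_solution I M G z \<longleftrightarrow>
     (\<forall>i\<in>I. 0 \<le> z i \<and> z i \<le> M \<and> (0 < G z i \<longrightarrow> z i = M) \<and> (G z i < 0 \<longrightarrow> z i = 0))"

text \<open>Bolzano-Weierstrass in finitely many coordinates, by induction on \<open>I\<close>: each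
  new coordinate costs one further subsequence.\<close>

lemma bounded_pointwise_subsequence:
  fixes z :: "nat \<Rightarrow> 'i \<Rightarrow> real"
  assumes "finite I" and "\<And>k i. i \<in> I \<Longrightarrow> 0 \<le> z k i \<and> z k i \<le> M"
  obtains r l where "strict_mono r" "\<And>i. i \<in> I \<Longrightarrow> (\<lambda>k. z (r k) i) \<longlonglongrightarrow> l i"
proof -
  have "\<exists>r. strict_mono r \<and> (\<forall>i\<in>I. convergent (\<lambda>k. z (r k) i))"
    using assms
  proof (induction I)
    case empty
    then show ?case using strict_mono_id by auto
  next
    case (insert a I)
    then obtain r where r: "strict_mono r" "\<forall>i\<in>I. convergent (\<lambda>k. z (r k) i)"
      by auto
    have "z (r k) a \<in> {0..M}" for k
      using insert.prems by auto
    then obtain l s where s: "strict_mono s" "((\<lambda>k. z (r k) a) \<circ> s) \<longlonglongrightarrow> l"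
      using compact_Icc[of 0 M] unfolding compact_def by meson
    have "convergent (\<lambda>k. z ((r \<circ> s) k) i)" if "i \<in> insert a I" for i
    proof (cases "i = a")
      case True
      then show ?thesis using s(2) by (auto simp: o_def convergent_def)
    next
      case False
      then have "convergent (\<lambda>k. z (r k) i)" using that r(2) by auto
      then show ?thesis
        using convergent_subseq_convergent[OF _ s(1)] by (fastforce simp: o_def)
    qed
    then show ?case using strict_mono_o[OF r(1) s(1)] by blast
  qed
  then obtain r where "strict_mono r" "\<forall>i\<in>I. convergent (\<lambda>k. z (r k) i)" by blast
  then show thesis
    using that[of r "\<lambda>i. lim (\<lambda>k. z (r k) i)"] by (auto simp: convergent_LIMSEQ_iff)
qed

text \<open>A strict sign of \<open>H l i\<close> is inherited by all late members of the
  subsequence, which therefore lie on the required face, and so does the limit. As \<open>I\<close>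
  is finite, the coordinates positive in the limit are simultaneously positive in one late member
  \<open>z k\<close>; this later compares the supports of two equilibria.\<close>

lemma box_solution_limit:
  fixes z :: "nat \<Rightarrow> 'i \<Rightarrow> real"
  assumes I: "finite I" and z: "\<And>k. box_solution I M (G k) (z k)"
    and lim: "\<And>r l i. strict_mono r \<Longrightarrow> (\<And>j. j \<in> I \<Longrightarrow> (\<lambda>k. z (r k) j) \<longlonglongrightarrow> l j) \<Longrightarrow> i \<in> I \<Longrightarrow>
      (\<lambda>k. G (r k) (z (r k)) i) \<longlonglongrightarrow> H l i"
  obtains l k where "box_solution I M H l" "\<And>i. i \<in> I \<Longrightarrow> 0 < l i \<Longrightarrow> 0 < z k i"
proof -
  have zb: "i \<in> I \<Longrightarrow> 0 \<le> z k i \<and> z k i \<le> M" for k i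
    using z by (auto simp: box_solution_def)
  obtain r l where r: "strict_mono r" and l: "\<And>i. i \<in> I \<Longrightarrow> (\<lambda>k. z (r k) i) \<longlonglongrightarrow> l i"
    using bounded_pointwise_subsequence[OF I, of z M] zb by blast
  have G: "(\<lambda>k. G (r k) (z (r k)) i) \<longlonglongrightarrow> H l i" if "i \<in> I" for i
    using lim r l that by blast
  have "box_solution I M H l"
    unfolding box_solution_def
  proof (intro ballI conjI impI)
    fix i assume i: "i \<in> I"
    show "0 \<le> l i" "l i \<le> M"
      using l[OF i] zb[OF i] by (auto intro: LIMSEQ_le_const LIMSEQ_le_const2)
    show "l i = M" if "0 < H l i"
    proof -
      have "\<forall>\<^sub>F k in sequentially. 0 < G (r k) (z (r k)) i"
        using order_tendstoD(1)[OF G[OF i] that] .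
      then have "\<forall>\<^sub>F k in sequentially. z (r k) i = M"
        using z i by (auto simp: box_solution_def elim: eventually_mono)
      then have "(\<lambda>k. z (r k) i) \<longlonglongrightarrow> M" by (rule tendsto_eventually)
      then show ?thesis using l[OF i] LIMSEQ_unique by blast
    qed
    show "l i = 0" if "H l i < 0"
    proof -
      have "\<forall>\<^sub>F k in sequentially. G (r k) (z (r k)) i < 0"
        using order_tendstoD(2)[OF G[OF i] that] .
      then have "\<forall>\<^sub>F k in sequentially. z (r k) i = 0"
        using z i by (auto simp: box_solution_def elim: eventually_mono)
      then have "(\<lambda>k. z (r k) i) \<longlonglongrightarrow> 0" by (rule tendsto_eventually)
      then show ?thesis using l[OF i] LIMSEQ_unique by blast
    qed
  qed
  moreover have "\<forall>\<^sub>F k in sequentially. \<forall>i\<in>I. 0 < l i \<longrightarrow> 0 < z (r k) i"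
    unfolding eventually_ball_finite_distrib[OF I] 
    using order_tendstoD(1)[OF l] by (auto intro: eventually_mono)
  then obtain k where "\<forall>i\<in>I. 0 < l i \<longrightarrow> 0 < z (r k) i"
    by (auto simp: eventually_sequentially)
  ultimately show thesis using that by blast
qed

text \<open>Kuhn's lemma is applied to ever finer grids on the cube, with labels given by the signs
  of \<open>G\<close>. The cells it finds shrink to a point, and continuity of \<open>G\<close>
  carries the sign information there.\<close>

lemma box_solution_exists:
  fixes G :: "('i \<Rightarrow> real) \<Rightarrow> 'i \<Rightarrow> real"
  assumes I: "finite I" and M: "0 < M"
    and cont: "\<And>zs l i. (\<And>j. j \<in> I \<Longrightarrow> (\<lambda>k. zs k j) \<longlonglongrightarrow> l j) \<Longrightarrow> i \<in> I \<Longrightarrow>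
      (\<lambda>k. G (zs k) i) \<longlonglongrightarrow> G l i"
  obtains z where "box_solution I M G z"
proof -
  obtain h where "bij_betw h I {0..<card I}"
    using ex_bij_betw_finite_nat[OF I] by blast
  then have h: "inj_on h I" "h ` I = {0..<card I}" by (auto simp: bij_betw_def)
  \<comment> \<open>For each direction \<open>i\<close>, the grid points \<open>R i\<close> and
    \<open>S i\<close> near the common corner \<open>q\<close> witness the two labels:
    \<open>G\<close> is positive at the first and not at the second, except that a face of the cube
    excuses the sign.\<close>
  have cell: "\<exists>q R S. \<forall>i\<in>I.
      (\<forall>j\<in>I. \<bar>R i j - q j\<bar> \<le> M / Suc m \<and> \<bar>S i j - q j\<bar> \<le> M / Suc m \<and> 0 \<le> q j \<and> q j \<le> M) \<and>
      (R i i = 0 \<or> 0 < G (R i) i) \<and> (S i i = M \<or> G (S i) i \<le> 0)" for m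
  proof -
    define pt where "pt x i = M * real (x (h i)) / Suc m" for x :: "nat \<Rightarrow> nat" and i
    \<comment> \<open>Kuhn's lemma prescribes label 0 on the lower face and label 1 on the upper
      face; elsewhere the label records the sign of \<open>G\<close>.\<close>
    define label where "label x k = (if x k = 0 \<or> x k \<noteq> Suc m \<and>
        0 < G (pt x) (the_inv_into I h k) then 0 else 1::nat)" for x k
    obtain q where q: "\<forall>i<card I. q i < Suc m"
      "\<forall>i<card I. \<exists>r s. (\<forall>j<card I. q j \<le> r j \<and> r j \<le> q j + 1) \<and>
         (\<forall>j<card I. q j \<le> s j \<and> s j \<le> q j + 1) \<and> label r i \<noteq> label s i"
      by (rule kuhn_lemma[of "Suc m" "card I" label]) (auto simp: label_def)
    have near: "\<bar>pt r j - pt q j\<bar> \<le> M / Suc m"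
      if "q (h j) \<le> r (h j)" "r (h j) \<le> q (h j) + 1" for r j
    proof -
      have "pt r j - pt q j = (M / Suc m) * (real (r (h j)) - real (q (h j)))"
        by (simp add: pt_def right_diff_distrib diff_divide_distrib)
      moreover have "\<bar>real (r (h j)) - real (q (h j))\<bar> \<le> 1" using that by auto
      ultimately show ?thesis using M 
        by (simp add: abs_mult mult_left_le divide_right_mono del: of_nat_Suc)
    qed
    have hI: "h j < card I" if "j \<in> I" for j using h(2) that by auto
    have qb: "0 \<le> pt q j \<and> pt q j \<le> M" if "j \<in> I" for j
    proof -
      have "real (q (h j)) \<le> Suc m" using q(1) hI[OF that] by (metis less_imp_le of_nat_mono)
      then show ?thesis using M by (auto simp: pt_def field_simps simp del: of_nat_Suc)
    qed
    have "\<exists>R S. (\<forall>j\<in>I. \<bar>R j - pt q j\<bar> \<le> M / Suc m \<and> \<bar>S j - pt q j\<bar> \<le> M / Suc m) \<and>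
      (R i = 0 \<or> 0 < G R i) \<and> (S i = M \<or> G S i \<le> 0)" if i: "i \<in> I" for i
    proof -
      have "\<exists>r s. (\<forall>j<card I. q j \<le> r j \<and> r j \<le> q j + 1) \<and>
         (\<forall>j<card I. q j \<le> s j \<and> s j \<le> q j + 1) \<and> label r (h i) = 0 \<and> label s (h i) \<noteq> 0"
      proof -
        obtain r s where rs: "(\<forall>j<card I. q j \<le> r j \<and> r j \<le> q j + 1)"
         "(\<forall>j<card I. q j \<le> s j \<and> s j \<le> q j + 1)" "label r (h i) \<noteq> label s (h i)"
          using q(2) hI[OF i] by blast
        moreover have "label r (h i) = 0 \<or> label s (h i) = 0"
          using rs(3) by (auto simp: label_def split: if_splits)
        ultimately show ?thesis by metis
      qed
      then obtain r s where rs: "\<forall>j<card I. q j \<le> r j \<and> r j \<le> q j + 1"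
         "\<forall>j<card I. q j \<le> s j \<and> s j \<le> q j + 1" "label r (h i) = 0" "label s (h i) \<noteq> 0"
        by blast
      have inv: "the_inv_into I h (h i) = i" by (rule the_inv_into_f_f[OF h(1) i])
      have "pt r i = 0 \<or> 0 < G (pt r) i"
        using rs(3) by (auto simp: label_def inv pt_def split: if_splits)
      moreover have "pt s i = M \<or> G (pt s) i \<le> 0"
        using rs(4) by (auto simp: label_def inv pt_def split: if_splits)
      ultimately show ?thesis
        using near rs(1,2) hI by (intro exI[of _ "pt r"] exI[of _ "pt s"]) auto
    qed
    then obtain R S where "\<forall>i\<in>I. (\<forall>j\<in>I. \<bar>R i j - pt q j\<bar> \<le> M / Suc m \<and> \<bar>S i j - pt q j\<bar> \<le> M / Suc m) \<and>
      (R i i = 0 \<or> 0 < G (R i) i) \<and> (S i i = M \<or> G (S i) i \<le> 0)" by metis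
    then show ?thesis using qb by blast
  qed
  define P where "P m q R S \<longleftrightarrow> (\<forall>i\<in>I.
      (\<forall>j\<in>I. \<bar>R i j - q j\<bar> \<le> M / Suc m \<and> \<bar>S i j - q j\<bar> \<le> M / Suc m \<and> 0 \<le> q j \<and> q j \<le> M) \<and>
      (R i i = 0 \<or> 0 < G (R i) i) \<and> (S i i = M \<or> G (S i) i \<le> 0))" for m q R S
  have "\<forall>m. \<exists>q R S. P m q R S" using cell by (simp add: P_def)
  then obtain q R S where P: "\<And>m. P m (q m) (R m) (S m)" by metis
  have qRS: "\<And>m i j. i \<in> I \<Longrightarrow> j \<in> I \<Longrightarrow> \<bar>R m i j - q m j\<bar> \<le> M / Suc m"
    "\<And>m i j. i \<in> I \<Longrightarrow> j \<in> I \<Longrightarrow> \<bar>S m i j - q m j\<bar> \<le> M / Suc m"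
    "\<And>m j. j \<in> I \<Longrightarrow> 0 \<le> q m j \<and> q m j \<le> M"
    "\<And>m i. i \<in> I \<Longrightarrow> R m i i = 0 \<or> 0 < G (R m i) i"
    "\<And>m i. i \<in> I \<Longrightarrow> S m i i = M \<or> G (S m i) i \<le> 0"
    using P unfolding P_def by blast+
  obtain r l where r: "strict_mono r" and l: "\<And>i. i \<in> I \<Longrightarrow> (\<lambda>k. q (r k) i) \<longlonglongrightarrow> l i"
    using bounded_pointwise_subsequence[OF I, of q M] qRS(3) by blast
  have "(\<lambda>m. M * inverse (real (Suc m))) \<longlonglongrightarrow> M * 0"
    by (intro tendsto_intros LIMSEQ_inverse_real_of_nat)
  from LIMSEQ_subseq_LIMSEQ[OF this r]
  have mesh: "(\<lambda>k. M / Suc (r k)) \<longlonglongrightarrow> 0" by (simp add: o_def divide_inverse)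
  have R: "(\<lambda>k. R (r k) i j) \<longlonglongrightarrow> l j" if "i \<in> I" "j \<in> I" for i j
  proof -
    have "(\<lambda>k. R (r k) i j - q (r k) j) \<longlonglongrightarrow> 0"
      by (rule Lim_null_comparison[OF _ mesh]) (use qRS(1) that in auto)
    from tendsto_add[OF this l[OF that(2)]] show ?thesis by simp
  qed
  have S: "(\<lambda>k. S (r k) i j) \<longlonglongrightarrow> l j" if "i \<in> I" "j \<in> I" for i j
  proof -
    have "(\<lambda>k. S (r k) i j - q (r k) j) \<longlonglongrightarrow> 0"
      by (rule Lim_null_comparison[OF _ mesh]) (use qRS(2) that in auto)
    from tendsto_add[OF this l[OF that(2)]] show ?thesis by simp
  qed
  have "box_solution I M G l"
    unfolding box_solution_def
  proof (intro ballI conjI impI)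
    fix i assume i: "i \<in> I"
    show "0 \<le> l i" "l i \<le> M"
      using l[OF i] qRS(3)[OF i] by (auto intro: LIMSEQ_le_const LIMSEQ_le_const2)
    \<comment> \<open>The points \<open>S\<close> converge to \<open>l\<close> as well, so
      \<open>G\<close> is eventually positive there, which \<open>S\<close> permits only on the
      upper face. The other sign uses \<open>R\<close> in the same way.\<close>
    show "l i = M" if "0 < G l i"
    proof -
      have "\<forall>\<^sub>F k in sequentially. 0 < G (S (r k) i) i"
        using order_tendstoD(1)[OF cont[of "\<lambda>k. S (r k) i", OF S[OF i] i] that] by simp
      then have "\<forall>\<^sub>F k in sequentially. S (r k) i i = M"
        by (rule eventually_mono) (use qRS(5)[OF i] in \<open>auto simp: not_le[symmetric]\<close>)
      then have "(\<lambda>k. S (r k) i i) \<longlonglongrightarrow> M" by (rule tendsto_eventually)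
      then show ?thesis using S[OF i i] LIMSEQ_unique by blast
    qed
    show "l i = 0" if "G l i < 0"
    proof -
      have "\<forall>\<^sub>F k in sequentially. G (R (r k) i) i < 0"
        using order_tendstoD(2)[OF cont[of "\<lambda>k. R (r k) i", OF R[OF i] i] that] by simp
      then have "\<forall>\<^sub>F k in sequentially. R (r k) i i = 0"
        by (rule eventually_mono) (use qRS(4)[OF i] in \<open>meson less_asym\<close>)
      then have "(\<lambda>k. R (r k) i i) \<longlonglongrightarrow> 0" by (rule tendsto_eventually)
      then show ?thesis using R[OF i i] LIMSEQ_unique by blast
    qed
  qed
  then show thesis by (rule that)
qed

section \<open>Equilibria of path packings\<close>

text \<open>Only the terminals of a path and the multiplicities \<open>n p e\<close> of its edges
  enter. By \<open>uses_edge\<close>, the capacities bound every rate.\<close>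

locale path_packing =
  fixes P :: "'p set" and E :: "'e set" and V :: "'v set"
    and n :: "'p \<Rightarrow> 'e \<Rightarrow> nat" and src snk :: "'p \<Rightarrow> 'v"
    and u :: "'e \<Rightarrow> real" and \<beta> :: "'v \<Rightarrow> real"
  assumes finite_P: "finite P" and finite_E: "finite E" and finite_V: "finite V"
    and uses_edge: "p \<in> P \<Longrightarrow> \<exists>e\<in>E. 0 < n p e"
    and src_in_V: "p \<in> P \<Longrightarrow> src p \<in> V" and snk_in_V: "p \<in> P \<Longrightarrow> snk p \<in> V"
    and u_nonneg: "e \<in> E \<Longrightarrow> 0 \<le> u e" and \<beta>_nonneg: "v \<in> V \<Longrightarrow> 0 \<le> \<beta> v"
begin

definition price :: "('e \<Rightarrow> real) \<Rightarrow> ('v \<Rightarrow> real) \<Rightarrow> 'p \<Rightarrow> real" where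
  "price l m p = m (src p) + m (snk p) + (\<Sum>e\<in>E. real (n p e) * l e)"

definition load :: "('p \<Rightarrow> real) \<Rightarrow> 'e \<Rightarrow> real" where
  "load x e = (\<Sum>p\<in>P. real (n p e) * x p)"

text \<open>If flow enters the path \<open>p\<close> at rate \<open>x p\<close> for
  \<open>w p\<close> time units, this is the total flow through the terminal \<open>v\<close>, for
  sources and sinks alike.\<close>

definition amount :: "('p \<Rightarrow> real) \<Rightarrow> ('p \<Rightarrow> real) \<Rightarrow> 'v \<Rightarrow> real" where
  "amount w x v = (\<Sum>p\<in>{p \<in> P. src p = v \<or> snk p = v}. x p * w p)"

text \<open>These are not the optimality conditions of a linear program: \<open>amount\<close>
  weights the rates by \<open>w p\<close>, while terminal prices enter \<open>price\<close>
  unweighted. Hence existence comes from a fixed-point argument instead of duality. The unweighted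
  form is what lets the ends of two paths be exchanged at no change in terminal prices.\<close>

definition equilibrium ::
  "('p \<Rightarrow> real) \<Rightarrow> ('p \<Rightarrow> real) \<Rightarrow> ('e \<Rightarrow> real) \<Rightarrow> ('v \<Rightarrow> real) \<Rightarrow> bool" where
  "equilibrium w x l m \<longleftrightarrow>
     (\<forall>p\<in>P. 0 \<le> x p \<and> w p \<le> price l m p \<and> (0 < x p \<longrightarrow> w p = price l m p)) \<and>
     (\<forall>e\<in>E. 0 \<le> l e \<and> load x e \<le> u e \<and> (0 < l e \<longrightarrow> load x e = u e)) \<and>
     (\<forall>v\<in>V. 0 \<le> m v \<and> amount w x v \<le> \<beta> v \<and> (0 < m v \<longrightarrow> amount w x v = \<beta> v))"

text \<open>An equilibrium solves the complementarity problem for \<open>slack\<close>; conversely, on a box of large size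
  its upper faces are never active.\<close>

definition slack :: "('p \<Rightarrow> real) \<Rightarrow> ('p + 'e + 'v \<Rightarrow> real) \<Rightarrow> 'p + 'e + 'v \<Rightarrow> real" where
  "slack w z i = (case i of
       Inl p \<Rightarrow> w p - price (z \<circ> Inr \<circ> Inl) (z \<circ> Inr \<circ> Inr) p
     | Inr (Inl e) \<Rightarrow> load (z \<circ> Inl) e - u e
     | Inr (Inr v) \<Rightarrow> amount w (z \<circ> Inl) v - \<beta> v)"

text \<open>Continuity is joint in weights and variables because the perturbation argument lets both
  vary.\<close>

lemma slack_tendsto:
  assumes w: "\<And>p. p \<in> P \<Longrightarrow> (\<lambda>k. ws k p) \<longlonglongrightarrow> w p"
    and z: "\<And>j. j \<in> P <+> (E <+> V) \<Longrightarrow> (\<lambda>k. zs k j) \<longlonglongrightarrow> z j"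
    and i: "i \<in> P <+> (E <+> V)"
  shows "(\<lambda>k. slack (ws k) (zs k) i) \<longlonglongrightarrow> slack w z i"
  using i
proof (elim PlusE)
  fix p assume p: "p \<in> P" "i = Inl p"
  show ?thesis
    unfolding p slack_def price_def sum.case o_def
    by (intro tendsto_intros w z) (use p src_in_V snk_in_V in auto)
next
  fix j e assume e: "i = Inr j" "j = Inl e" "e \<in> E"
  show ?thesis
    unfolding e slack_def load_def sum.case o_def
    by (intro tendsto_intros w z) (use e in auto)
next
  fix j v assume v: "i = Inr j" "j = Inr v" "v \<in> V"
  show ?thesis
    unfolding v slack_def amount_def sum.case o_def
    by (intro tendsto_intros w z) auto
qed

lemma price_bounds:
  assumes "p \<in> P" and l: "\<And>e. e \<in> E \<Longrightarrow> 0 \<le> l e" and m: "\<And>v. v \<in> V \<Longrightarrow> 0 \<le> m v"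
  shows "0 \<le> price l m p" "e \<in> E \<Longrightarrow> real (n p e) * l e \<le> price l m p"
    "m (src p) \<le> price l m p" "m (snk p) \<le> price l m p"
proof -
  have m': "0 \<le> m (src p)" "0 \<le> m (snk p)" using assms src_in_V snk_in_V by auto
  have s: "0 \<le> (\<Sum>e\<in>E. real (n p e) * l e)" using l by (intro sum_nonneg) auto
  show "0 \<le> price l m p" "m (src p) \<le> price l m p" "m (snk p) \<le> price l m p"
    using m' s by (auto simp: price_def)
  show "real (n p e) * l e \<le> price l m p" if "e \<in> E"
  proof -
    have "real (n p e) * l e \<le> (\<Sum>e\<in>E. real (n p e) * l e)"
      using that l finite_E by (intro member_le_sum) auto
    then show ?thesis using m' by (simp add: price_def)
  qed
qed

lemma equilibrium_if_box_solution:
  assumes z: "box_solution (P <+> (E <+> V)) M (slack w) z"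
    and w: "\<And>p. p \<in> P \<Longrightarrow> w p < M" and u: "\<And>e. e \<in> E \<Longrightarrow> u e < M" and M: "0 < M"
  shows "equilibrium w (z \<circ> Inl) (z \<circ> Inr \<circ> Inl) (z \<circ> Inr \<circ> Inr)"
proof -
  define x l m where xlm: "x = z \<circ> Inl" "l = z \<circ> Inr \<circ> Inl" "m = z \<circ> Inr \<circ> Inr"
  have x: "0 \<le> x p \<and> x p \<le> M \<and> (price l m p < w p \<longrightarrow> x p = M) \<and> (w p < price l m p \<longrightarrow> x p = 0)"
    if "p \<in> P" for p
    using z[unfolded box_solution_def, rule_format, of "Inl p"] that
    by (auto simp: xlm slack_def)
  have l: "0 \<le> l e \<and> l e \<le> M \<and> (u e < load x e \<longrightarrow> l e = M) \<and> (load x e < u e \<longrightarrow> l e = 0)"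
    if "e \<in> E" for e
    using z[unfolded box_solution_def, rule_format, of "Inr (Inl e)"] that
    by (auto simp: xlm slack_def)
  have m: "0 \<le> m v \<and> m v \<le> M \<and> (\<beta> v < amount w x v \<longrightarrow> m v = M) \<and> (amount w x v < \<beta> v \<longrightarrow> m v = 0)"
    if "v \<in> V" for v
    using z[unfolded box_solution_def, rule_format, of "Inr (Inr v)"] that
    by (auto simp: xlm slack_def)
  have price: "real (n p e) * l e \<le> price l m p" "m (src p) \<le> price l m p" "m (snk p) \<le> price l m p"
    if "p \<in> P" "e \<in> E" for p e
    using price_bounds[of p l m] that l m by auto
  have load: "load x e \<le> u e" if e: "e \<in> E" for e
  proof (rule ccontr)
    assume "\<not> ?thesis"
    then have lM: "l e = M" and gt: "u e < load x e" using l[OF e] by auto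
    have "real (n p e) * x p = 0" if p: "p \<in> P" for p
    proof (cases "n p e = 0")
      case False
      then have "M \<le> real (n p e) * l e" using lM M by (simp add: mult_le_cancel_right1)
      then have "w p < price l m p" using w[OF p] price(1)[OF p e] by linarith
      then show ?thesis using x[OF p] by simp
    qed simp
    then have "load x e = 0" unfolding load_def by (rule sum.neutral[OF ballI])
    then show False using gt u_nonneg[OF e] by simp
  qed
  have am: "amount w x v \<le> \<beta> v" if v: "v \<in> V" for v
  proof (rule ccontr)
    assume "\<not> ?thesis"
    then have mM: "m v = M" and gt: "\<beta> v < amount w x v" using m[OF v] by auto
    have "x p * w p = 0" if p: "p \<in> {p \<in> P. src p = v \<or> snk p = v}" for p
    proof -
      obtain e where "e \<in> E" using uses_edge p by blast
      then have "w p < price l m p" using w[of p] price(2,3)[of p e] mM p by auto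
      then show ?thesis using x[of p] p by simp
    qed
    then have "amount w x v = 0" unfolding amount_def by (rule sum.neutral[OF ballI])
    then show False using gt \<beta>_nonneg[OF v] by simp
  qed
  have pr: "w p \<le> price l m p" if p: "p \<in> P" for p
  proof (rule ccontr)
    assume "\<not> ?thesis"
    then have xM: "x p = M" using x[OF p] by auto
    obtain e where e: "e \<in> E" "0 < n p e" using uses_edge[OF p] by blast
    have "M \<le> real (n p e) * x p" using xM e M by (simp add: mult_le_cancel_right1)
    also have "\<dots> \<le> load x e"
      unfolding load_def using p x finite_P by (intro member_le_sum) auto
    also have "\<dots> < M" using load[OF e(1)] u[OF e(1)] by simp
    finally show False by simp
  qed
  show ?thesis
    unfolding equilibrium_def xlm(1)[symmetric] xlm(2)[symmetric] xlm(3)[symmetric]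
  proof (intro conjI ballI)
    fix p assume p: "p \<in> P"
    show "0 \<le> x p" "w p \<le> price l m p" "0 < x p \<longrightarrow> w p = price l m p"
      using x[OF p] pr[OF p] by auto
  next
    fix e assume e: "e \<in> E"
    show "0 \<le> l e" "load x e \<le> u e" "0 < l e \<longrightarrow> load x e = u e"
      using l[OF e] load[OF e] by auto
  next
    fix v assume v: "v \<in> V"
    show "0 \<le> m v" "amount w x v \<le> \<beta> v" "0 < m v \<longrightarrow> amount w x v = \<beta> v"
      using m[OF v] am[OF v] by auto
  qed
qed

text \<open>Subtracting \<epsilon> per edge amounts to lengthening all transit times by \<epsilon>.
  Equilibria for \<open>1 / (k + 1)\<close> in place of \<epsilon> accumulate at one for
  \<open>w\<close>, whose support is contained in that of some perturbed equilibrium.\<close>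

lemma perturbed_equilibrium:
  fixes w :: "'p \<Rightarrow> real"
  obtains x l m x' l' m' \<epsilon> where "equilibrium w x l m" "0 < \<epsilon>"
    "equilibrium (\<lambda>p. w p - \<epsilon> * (\<Sum>e\<in>E. real (n p e))) x' l' m'"
    "\<And>p. p \<in> P \<Longrightarrow> 0 < x p \<Longrightarrow> 0 < x' p"
proof -
  \<comment> \<open>This exceeds all weights and capacities; perturbing only lowers the weights, so
    the same \<open>M\<close> serves every \<open>k\<close>.\<close>
  define M where "M = 1 + (\<Sum>p\<in>P. \<bar>w p\<bar>) + (\<Sum>e\<in>E. u e)"
  define I where "I = P <+> (E <+> V)"
  define wk where "wk k p = w p - inverse (real (Suc k)) * (\<Sum>e\<in>E. real (n p e))" for k p
  have pos: "0 \<le> (\<Sum>p\<in>P. \<bar>w p\<bar>)" "0 \<le> (\<Sum>e\<in>E. u e)"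
    using u_nonneg by (auto intro: sum_nonneg)
  have wM: "w p < M" if "p \<in> P" for p
    using member_le_sum[OF that, of "\<lambda>p. \<bar>w p\<bar>"] pos finite_P by (simp add: M_def)
  have uM: "u e < M" if "e \<in> E" for e
  proof -
    have "u e \<le> (\<Sum>e\<in>E. u e)" using that finite_E u_nonneg by (intro member_le_sum) auto
    then show ?thesis using pos unfolding M_def by linarith
  qed
  have M: "0 < M" using pos unfolding M_def by linarith
  have wkM: "wk k p < M" if "p \<in> P" for k p
  proof -
    have "0 \<le> inverse (real (Suc k)) * (\<Sum>e\<in>E. real (n p e))" by (intro mult_nonneg_nonneg sum_nonneg) auto
    then show ?thesis using wM[OF that] unfolding wk_def by linarith
  qed
  have I: "finite I" using finite_P finite_E finite_V by (simp add: I_def)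
  have "\<exists>z. box_solution I M (slack (wk k)) z" for k
    by (rule box_solution_exists[OF I M, of "slack (wk k)"])
      (auto intro!: slack_tendsto[folded I_def])
  then obtain z where z: "\<And>k. box_solution I M (slack (wk k)) (z k)" by metis
  obtain y k where y: "box_solution I M (slack w) y" "\<And>i. i \<in> I \<Longrightarrow> 0 < y i \<Longrightarrow> 0 < z k i"
  proof (rule box_solution_limit[OF I z, where H = "slack w"])
    fix r l i
    assume r: "strict_mono r" and l: "\<And>j. j \<in> I \<Longrightarrow> (\<lambda>k. z (r k) j) \<longlonglongrightarrow> l j" and i: "i \<in> I"
    have "(\<lambda>k. wk k p) \<longlonglongrightarrow> w p - 0 * (\<Sum>e\<in>E. real (n p e))" for p
      unfolding wk_def by (intro tendsto_intros LIMSEQ_inverse_real_of_nat)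
    then have "(\<lambda>k. wk (r k) p) \<longlonglongrightarrow> w p" for p
      using LIMSEQ_subseq_LIMSEQ[OF _ r] by (fastforce simp: o_def)
    then show "(\<lambda>k. slack (wk (r k)) (z (r k)) i) \<longlonglongrightarrow> slack w l i"
      using slack_tendsto[folded I_def, of "\<lambda>k. wk (r k)" w "\<lambda>k. z (r k)" l i] l i by blast
  qed blast
  show thesis
    using equilibrium_if_box_solution[OF y(1)[unfolded I_def] wM uM M]
      equilibrium_if_box_solution[OF z[of k, unfolded I_def] wkM uM M] y(2)
    by (intro that[of "y \<circ> Inl" "y \<circ> Inr \<circ> Inl" "y \<circ> Inr \<circ> Inr" "inverse (real (Suc k))"
          "z k \<circ> Inl" "z k \<circ> Inr \<circ> Inl" "z k \<circ> Inr \<circ> Inr"]) (auto simp: I_def wk_def)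
qed

end

section \<open>Lower bounds on the value of an equilibrium\<close>

context path_packing begin

text \<open>A weight may be negative, but on a used path it equals a price.\<close>

lemma equilibrium_work_nonneg:
  assumes "equilibrium w x l m" and p: "p \<in> P"
  shows "0 \<le> x p * w p"
proof (cases "x p = 0")
  case False
  then have "0 < x p" "w p = price l m p"
    using assms by (auto simp: equilibrium_def order.order_iff_strict)
  moreover have "0 \<le> price l m p"
    using assms by (intro price_bounds) (auto simp: equilibrium_def)
  ultimately show ?thesis by simp
qed simp

text \<open>Complementary slackness replaces \<open>u e\<close> by \<open>load x e\<close>. After
  exchanging the sums, each used path contributes its rate times the edge part of its price, and the
  full price is \<open>w p\<close>.\<close>

lemma edge_prices_le_work:
  assumes eq: "equilibrium w x l m"
  shows "(\<Sum>e\<in>E. l e * u e) \<le> (\<Sum>p\<in>P. x p * w p)"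
proof -
  have "(\<Sum>e\<in>E. l e * u e) = (\<Sum>e\<in>E. l e * load x e)"
    using eq by (intro sum.cong) (auto simp: equilibrium_def order.order_iff_strict)
  also have "\<dots> = (\<Sum>e\<in>E. \<Sum>p\<in>P. x p * (real (n p e) * l e))"
    by (simp add: load_def sum_distrib_left mult_ac)
  also have "\<dots> = (\<Sum>p\<in>P. x p * (\<Sum>e\<in>E. real (n p e) * l e))"
    by (subst sum.swap) (simp add: sum_distrib_left)
  also have "\<dots> \<le> (\<Sum>p\<in>P. x p * w p)"
  proof (rule sum_mono)
    fix p assume p: "p \<in> P"
    show "x p * (\<Sum>e\<in>E. real (n p e) * l e) \<le> x p * w p"
    proof (cases "x p = 0")
      case False
      then have "0 < x p" "w p = price l m p"
        using eq p by (auto simp: equilibrium_def order.order_iff_strict)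
      moreover have "0 \<le> m (src p)" "0 \<le> m (snk p)"
        using eq p src_in_V snk_in_V by (auto simp: equilibrium_def)
      ultimately show ?thesis by (simp add: price_def)
    qed simp
  qed
  finally show ?thesis .
qed

text \<open>Terminals with a positive price exhaust their balance. No path has both ends in
  \<open>S\<close>, so no path is counted twice.\<close>

lemma terminal_balances_le_work:
  assumes eq: "equilibrium w x l m" and S: "S \<subseteq> V"
    and disj: "\<And>p. p \<in> P \<Longrightarrow> \<not> (src p \<in> S \<and> snk p \<in> S)"
  shows "(\<Sum>v\<in>{v \<in> S. 0 < m v}. \<beta> v) \<le> (\<Sum>p\<in>P. x p * w p)"
proof -
  let ?S = "{v \<in> S. 0 < m v}" and ?A = "\<lambda>v. {p \<in> P. src p = v \<or> snk p = v}"
  have fin: "finite ?S" using S finite_V by (auto intro: finite_subset)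
  have "(\<Sum>v\<in>?S. \<beta> v) = (\<Sum>v\<in>?S. amount w x v)"
    using eq S by (intro sum.cong) (auto simp: equilibrium_def)
  also have "\<dots> = (\<Sum>p\<in>(\<Union>v\<in>?S. ?A v). x p * w p)"
    unfolding amount_def
    by (rule sum.UNION_disjoint[symmetric]) (use fin finite_P disj in auto)
  also have "\<dots> \<le> (\<Sum>p\<in>P. x p * w p)"
    using finite_P equilibrium_work_nonneg[OF eq] by (intro sum_mono2) auto
  finally show ?thesis .
qed

end

section \<open>Temporally repeated flows\<close>

text \<open>For a window of length \<open>w\<close> opening at time 0, this is how long it has been
  open by time \<theta>; it is 0 before the opening.\<close>

definition elapsed :: "real \<Rightarrow> real \<Rightarrow> real" where
  "elapsed w \<theta> = max 0 (min \<theta> w)"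

text \<open>Flow enters the first arc of the walk during \<open>[s, s + w)\<close>, at rate 1.\<close>

fun walk_rate :: "('a \<Rightarrow> real) \<Rightarrow> real \<Rightarrow> real \<Rightarrow> 'a list \<Rightarrow> 'a \<Rightarrow> real \<Rightarrow> real" where
  "walk_rate \<tau> w s [] a \<xi> = 0"
| "walk_rate \<tau> w s (c # p) a \<xi> =
     (if a = c then indicator {s..<s + w} \<xi> else 0) + walk_rate \<tau> w (s + \<tau> c) p a \<xi>"

lemma walk_rate_nonneg: "0 \<le> walk_rate \<tau> w s p a \<xi>"
  by (induction p arbitrary: s) auto

lemma walk_rate_le_count: "walk_rate \<tau> w s p a \<xi> \<le> count_list p a"
proof (induction p arbitrary: s)
  case (Cons c p)
  then show ?case using Cons[of "s + \<tau> c"] order_trans[OF Cons[of "s + \<tau> c"], of "1 + real (count_list p a)"]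
    by (auto simp: indicator_def)
qed simp

text \<open>What precedes an occurrence of \<open>a\<close> takes at most the transit time of the
  whole walk minus \<open>\<tau> a\<close>. If \<open>s = 0\<close> and \<open>w\<close> plus the
  walk's transit time is \<open>T\<close>, no flow is left on an arc at time
  \<open>T\<close>.\<close>

lemma walk_rate_eq_0:
  assumes "\<And>c. c \<in> set p \<Longrightarrow> 0 \<le> \<tau> c" and "s + w + sum_list (map \<tau> p) - \<tau> a \<le> \<xi>"
  shows "walk_rate \<tau> w s p a \<xi> = 0"
  using assms
proof (induction p arbitrary: s)
  case (Cons c p)
  have "0 \<le> sum_list (map \<tau> p)" using Cons.prems(1) by (intro sum_list_nonneg) auto
  then show ?case using Cons.prems Cons.IH[of "s + \<tau> c"] by (auto simp: algebra_simps)
qed simp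

lemma integrable_indicator_Ico: "integrable lebesgue (indicator {a..<b :: real} :: real \<Rightarrow> real)"
proof (rule integrable_real_indicator)
  show "emeasure lebesgue {a..<b} < \<infinity>"
    by (cases "a \<le> b") (simp_all add: emeasure_completion)
qed simp

lemma integrable_walk_rate: "integrable lebesgue (walk_rate \<tau> w s p a)"
proof (induction p arbitrary: s)
  case Nil
  have "walk_rate \<tau> w s [] a = (\<lambda>\<xi>. 0)" by auto
  then show ?case by simp
next
  case (Cons c p)
  have "integrable lebesgue (indicator {s..<s + w} :: real \<Rightarrow> real)"
    by (rule integrable_indicator_Ico)
  then have "integrable lebesgue (\<lambda>\<xi>. (if a = c then indicator {s..<s + w} \<xi> else 0) + walk_rate \<tau> w (s + \<tau> c) p a \<xi>)"
    using Cons by (intro Bochner_Integration.integrable_add) (cases "a = c"; simp)+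
  then show ?case by (simp cong: integrable_cong)
qed

lemma set_integrable_walk_rate: "A \<in> sets lebesgue \<Longrightarrow> set_integrable lebesgue A (walk_rate \<tau> w s p a)"
  unfolding set_integrable_def using integrable_walk_rate
  by (rule integrable_mult_indicator[rotated])

lemma integral_window:
  assumes "0 \<le> s"
  shows "(LINT \<xi>:{0..<\<theta>}|lebesgue. indicator {s..<s + w} \<xi>) = elapsed w (\<theta> - s)"
proof -
  have "(LINT \<xi>:{0..<\<theta>}|lebesgue. indicator {s..<s + w} \<xi> :: real) =
      (LINT \<xi>|lebesgue. indicator {s..<min \<theta> (s + w)} \<xi>)"
    unfolding set_lebesgue_integral_def using assms
    by (intro Bochner_Integration.integral_cong) (auto simp: indicator_def)
  also have "\<dots> = measure lebesgue {s..<min \<theta> (s + w)}" by simp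
  also have "\<dots> = elapsed w (\<theta> - s)"
    by (cases "s \<le> min \<theta> (s + w)") (auto simp: elapsed_def)
  finally show ?thesis .
qed

lemma excess_sum:
  assumes "finite P"
    and "\<And>p a \<theta>. p \<in> P \<Longrightarrow> a \<in> arcs D \<Longrightarrow> set_integrable lebesgue {0..<\<theta>} (f p a)"
  shows "excess D \<tau> (\<lambda>a \<xi>. \<Sum>p\<in>P. x p * f p a \<xi>) v \<theta> = (\<Sum>p\<in>P. x p * excess D \<tau> (f p) v \<theta>)"
proof -
  have "(LINT \<xi>:{0..<\<theta>}|lebesgue. \<Sum>p\<in>P. x p * f p a \<xi>) = (\<Sum>p\<in>P. x p * (LINT \<xi>:{0..<\<theta>}|lebesgue. f p a \<xi>))"
    if "a \<in> arcs D" for a \<theta>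
  proof -
    have "(LINT \<xi>:{0..<\<theta>}|lebesgue. \<Sum>p\<in>P. x p * f p a \<xi>) =
        (LINT \<xi>|lebesgue. (\<Sum>p\<in>P. x p * (indicator {0..<\<theta>} \<xi> *\<^sub>R f p a \<xi>)))"
      unfolding set_lebesgue_integral_def by (simp add: sum_distrib_left mult_ac)
    also have "\<dots> = (\<Sum>p\<in>P. LINT \<xi>|lebesgue. x p * (indicator {0..<\<theta>} \<xi> *\<^sub>R f p a \<xi>))"
      using assms(2) that unfolding set_integrable_def
      by (intro Bochner_Integration.integral_sum integrable_mult_right) auto
    also have "\<dots> = (\<Sum>p\<in>P. x p * (LINT \<xi>:{0..<\<theta>}|lebesgue. f p a \<xi>))"
      unfolding set_lebesgue_integral_def by simp
    finally show ?thesis .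
  qed
  then show ?thesis
    by (simp add: excess_def right_diff_distrib sum_subtractf sum_distrib_left sum.swap[of _ P])
qed

text \<open>The excess telescopes: the flow leaving one arc enters the next one without delay, so
  only the two ends of the walk contribute.\<close>

lemma excess_walk_rate:
  assumes "finite (arcs D)" and "pre_digraph.cas D y p z" and "set p \<subseteq> arcs D"
    and "\<And>c. c \<in> arcs D \<Longrightarrow> 0 \<le> \<tau> c" and "0 \<le> s"
  shows "excess D \<tau> (walk_rate \<tau> w s p) v \<theta> =
    (if z = v then elapsed w (\<theta> - s - sum_list (map \<tau> p)) else 0) - (if y = v then elapsed w (\<theta> - s) else 0)"
  using assms
proof (induction p arbitrary: y s)
  case Nil
  then show ?case by (simp add: excess_def pre_digraph.cas.simps set_lebesgue_integral_def)
next
  case (Cons c p)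
  let ?g = "\<lambda>a. if a = c then indicator {s..<s + w} else (\<lambda>_. 0 :: real)"
  have c: "c \<in> arcs D" "tail D c = y" "0 \<le> \<tau> c" using Cons.prems by (auto simp: pre_digraph.cas.simps)
  have ind: "integrable lebesgue (indicator {s..<s + w} :: real \<Rightarrow> real)"
    by (rule integrable_indicator_Ico)
  have split: "(LINT \<xi>:{0..<\<theta>}|lebesgue. walk_rate \<tau> w s (c # p) a \<xi>) =
    (if a = c then elapsed w (\<theta> - s) else 0) + (LINT \<xi>:{0..<\<theta>}|lebesgue. walk_rate \<tau> w (s + \<tau> c) p a \<xi>)" for a \<theta>
  proof -
    have "set_integrable lebesgue {0..<\<theta>} (?g a)"
      unfolding set_integrable_def using ind by (intro integrable_mult_indicator) auto
    then have "(LINT \<xi>:{0..<\<theta>}|lebesgue. ?g a \<xi> + walk_rate \<tau> w (s + \<tau> c) p a \<xi>) =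
      (LINT \<xi>:{0..<\<theta>}|lebesgue. ?g a \<xi>) + (LINT \<xi>:{0..<\<theta>}|lebesgue. walk_rate \<tau> w (s + \<tau> c) p a \<xi>)"
      by (intro set_integral_add set_integrable_walk_rate) auto
    moreover have "(LINT \<xi>:{0..<\<theta>}|lebesgue. ?g a \<xi>) = (if a = c then elapsed w (\<theta> - s) else 0)"
      using integral_window[OF Cons.prems(5)] by (auto simp: set_lebesgue_integral_def)
    moreover have "(\<lambda>\<xi>. walk_rate \<tau> w s (c # p) a \<xi>) = (\<lambda>\<xi>. ?g a \<xi> + walk_rate \<tau> w (s + \<tau> c) p a \<xi>)"
      by auto
    ultimately show ?thesis by simp
  qed
  have fin: "finite (in_arcs D v)" "finite (out_arcs D v)"
    using Cons.prems(1) by (auto simp: in_arcs_def out_arcs_def)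
  have "excess D \<tau> (walk_rate \<tau> w s (c # p)) v \<theta> =
    (\<Sum>a\<in>in_arcs D v. if a = c then elapsed w (\<theta> - \<tau> a - s) else 0) -
    (\<Sum>a\<in>out_arcs D v. if a = c then elapsed w (\<theta> - s) else 0) +
    excess D \<tau> (walk_rate \<tau> w (s + \<tau> c) p) v \<theta>"
    unfolding excess_def split by (simp add: sum.distrib)
  also have "\<dots> = (if head D c = v then elapsed w (\<theta> - \<tau> c - s) else 0) - (if y = v then elapsed w (\<theta> - s) else 0) +
    excess D \<tau> (walk_rate \<tau> w (s + \<tau> c) p) v \<theta>"
    using fin c by (simp add: sum.delta' in_arcs_def out_arcs_def)
  also have "excess D \<tau> (walk_rate \<tau> w (s + \<tau> c) p) v \<theta> =
    (if z = v then elapsed w (\<theta> - (s + \<tau> c) - sum_list (map \<tau> p)) else 0) -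
    (if head D c = v then elapsed w (\<theta> - (s + \<tau> c)) else 0)"
    using Cons.prems c by (intro Cons.IH) (auto simp: pre_digraph.cas.simps)
  finally show ?case by (simp add: diff_diff_eq add.assoc add.commute del: walk_rate.simps)
qed

text \<open>By telescoping, only ends of walks have nonzero excess. The signs of \<open>b\<close>
  there make a source purely sending and a sink purely receiving, so bounding the final amounts
  bounds the excess at all times.\<close>

lemma temporally_repeated_flow:
  fixes src snk :: "'p \<Rightarrow> 'v" and walk :: "'p \<Rightarrow> 'a list" and \<tau> :: "'a \<Rightarrow> real" and T :: real
    and D :: "('v, 'a) pre_digraph"
    and x :: "'p \<Rightarrow> real" and u :: "'a \<Rightarrow> real" and b :: "'v \<Rightarrow> real"
  defines "w p \<equiv> T - sum_list (map \<tau> (walk p))"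
  assumes fin: "finite (verts D)" "finite (arcs D)" "finite P"
    and \<tau>: "\<And>a. a \<in> arcs D \<Longrightarrow> 0 \<le> \<tau> a"
    and walk: "\<And>p. p \<in> P \<Longrightarrow> pre_digraph.cas D (src p) (walk p) (snk p) \<and> set (walk p) \<subseteq> arcs D"
    and src: "\<And>p. p \<in> P \<Longrightarrow> 0 < b (src p)"
    and snk: "\<And>p. p \<in> P \<Longrightarrow> snk p \<in> verts D \<and> b (snk p) < 0"
    and x: "\<And>p. p \<in> P \<Longrightarrow> 0 \<le> x p" and w: "\<And>p. p \<in> P \<Longrightarrow> 0 \<le> w p"
    and cap: "\<And>a. a \<in> arcs D \<Longrightarrow> (\<Sum>p\<in>P. x p * count_list (walk p) a) \<le> u a"
    and out_bound: "\<And>v. v \<in> verts D \<Longrightarrow> 0 < b v \<Longrightarrow> (\<Sum>p\<in>{p \<in> P. src p = v}. x p * w p) \<le> b v"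
    and in_bound: "\<And>v. v \<in> verts D \<Longrightarrow> b v < 0 \<Longrightarrow> (\<Sum>p\<in>{p \<in> P. snk p = v}. x p * w p) \<le> - b v"
  defines "g a \<xi> \<equiv> \<Sum>p\<in>P. x p * walk_rate \<tau> (w p) 0 (walk p) a \<xi>"
  shows "flow_over_time D u b \<tau> T g" and "flow_value D b \<tau> T g = (\<Sum>p\<in>P. x p * w p)"
proof -
  define len where "len p = sum_list (map \<tau> (walk p))" for p
  have g: "g = (\<lambda>a \<xi>. \<Sum>p\<in>P. x p * walk_rate \<tau> (w p) 0 (walk p) a \<xi>)"
    by (simp add: g_def fun_eq_iff)
  have ex: "excess D \<tau> g v \<theta> = (\<Sum>p\<in>P. x p * (if snk p = v then elapsed (w p) (\<theta> - len p) else 0)) -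
     (\<Sum>p\<in>P. x p * (if src p = v then elapsed (w p) \<theta> else 0))" for v \<theta>
  proof -
    have "excess D \<tau> g v \<theta> = (\<Sum>p\<in>P. x p * excess D \<tau> (walk_rate \<tau> (w p) 0 (walk p)) v \<theta>)"
      unfolding g by (rule excess_sum) (auto intro: fin set_integrable_walk_rate)
    also have "\<dots> = (\<Sum>p\<in>P. x p * ((if snk p = v then elapsed (w p) (\<theta> - len p) else 0) -
        (if src p = v then elapsed (w p) \<theta> else 0)))"
    proof (rule sum.cong[OF refl])
      fix p assume p: "p \<in> P"
      show "x p * excess D \<tau> (walk_rate \<tau> (w p) 0 (walk p)) v \<theta> =
        x p * ((if snk p = v then elapsed (w p) (\<theta> - len p) else 0) -
        (if src p = v then elapsed (w p) \<theta> else 0))"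
        using excess_walk_rate[OF fin(2), of "src p" "walk p" "snk p" \<tau> 0 "w p" v \<theta>] walk[OF p] \<tau>
        by (simp add: len_def)
    qed
    finally show ?thesis by (simp only: right_diff_distrib sum_subtractf)
  qed
  have el: "0 \<le> elapsed (w p) \<theta>" "elapsed (w p) \<theta> \<le> w p" if "p \<in> P" for p \<theta>
    using w[OF that] by (auto simp: elapsed_def)
  have ex_source: "excess D \<tau> g v \<theta> = - (\<Sum>p\<in>{p \<in> P. src p = v}. x p * elapsed (w p) \<theta>)" if "0 \<le> b v" for v \<theta>
  proof -
    have "(\<Sum>p\<in>P. x p * (if snk p = v then elapsed (w p) (\<theta> - len p) else 0)) = 0"
      using snk that by (intro sum.neutral) force
    then show ?thesis
      unfolding ex using fin(3) by (simp add: sum.inter_filter if_distrib cong: if_cong)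
  qed
  have ex_sink: "excess D \<tau> g v \<theta> = (\<Sum>p\<in>{p \<in> P. snk p = v}. x p * elapsed (w p) (\<theta> - len p))" if "b v \<le> 0" for v \<theta>
  proof -
    have "(\<Sum>p\<in>P. x p * (if src p = v then elapsed (w p) \<theta> else 0)) = 0"
      using src that by (intro sum.neutral) force
    then show ?thesis
      unfolding ex using fin(3) by (simp add: sum.inter_filter if_distrib cong: if_cong)
  qed
  have bnd: "0 \<le> (\<Sum>p\<in>{p \<in> P. Q p}. x p * elapsed (w p) (t p))"
    "(\<Sum>p\<in>{p \<in> P. Q p}. x p * elapsed (w p) (t p)) \<le> (\<Sum>p\<in>{p \<in> P. Q p}. x p * w p)" for Q t
    using x el by (auto intro!: sum_nonneg sum_mono mult_left_mono)
  have "conserving_flow_over_time D b \<tau> T g"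
    unfolding conserving_flow_over_time_def
  proof (intro conjI ballI impI)
    fix a assume "a \<in> arcs D"
    show "set_integrable lebesgue {0..<T} (g a)"
      unfolding g set_integrable_def
      by (intro integrable_mult_indicator Bochner_Integration.integrable_sum
          Bochner_Integration.integrable_mult_right integrable_walk_rate) auto
  next
    fix a \<xi> assume "a \<in> arcs D" "\<xi> \<in> {0..<T}"
    show "0 \<le> g a \<xi>"
      unfolding g using x by (intro sum_nonneg mult_nonneg_nonneg walk_rate_nonneg)
  next
    fix a \<xi> assume a: "a \<in> arcs D" "\<xi> \<in> {0..<T}" "T - \<tau> a \<le> \<xi>"
    have "walk_rate \<tau> (w p) 0 (walk p) a \<xi> = 0" if "p \<in> P" for p
      using walk[OF that] \<tau> a(3) by (intro walk_rate_eq_0) (auto simp: w_def)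
    then show "g a \<xi> = 0" unfolding g by simp
  next
    fix v \<theta> assume v: "v \<in> verts D" "b v = 0"
    have "{p \<in> P. src p = v} = {}" using src v(2) by force
    then have "excess D \<tau> g v \<theta> = 0" for \<theta> using ex_source[of v \<theta>] v(2) by (simp only: sum.empty)
    then show "0 \<le> excess D \<tau> g v \<theta>" "excess D \<tau> g v T = 0" by simp_all
  next
    fix v \<theta> assume v: "v \<in> verts D" "0 < b v"
    show "- b v \<le> excess D \<tau> g v \<theta>" "excess D \<tau> g v \<theta> \<le> 0"
      using ex_source[of v] v bnd[where Q = "\<lambda>p. src p = v" and t = "\<lambda>_. \<theta>"] out_bound[OF v] by auto
  next
    fix v \<theta> assume v: "v \<in> verts D" "b v < 0"
    show "0 \<le> excess D \<tau> g v \<theta>" "excess D \<tau> g v \<theta> \<le> - b v"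
      using ex_sink[of v] v bnd[where Q = "\<lambda>p. snk p = v" and t = "\<lambda>p. \<theta> - len p"] in_bound[OF v] by auto
  qed
  moreover have "g a \<xi> \<le> u a" if "a \<in> arcs D" for a \<xi>
  proof -
    have "g a \<xi> \<le> (\<Sum>p\<in>P. x p * count_list (walk p) a)"
      unfolding g using x by (intro sum_mono mult_left_mono walk_rate_le_count)
    then show ?thesis using cap[OF that] by simp
  qed
  ultimately show "flow_over_time D u b \<tau> T g" by (simp add: flow_over_time_def)
  \<comment> \<open>At time \<open>T\<close> each window is complete at its sink, because
    \<open>T - len p = w p\<close>.\<close>
  have "excess D \<tau> g v T = (\<Sum>p\<in>{p \<in> P. snk p = v}. x p * w p)" if "b v < 0" for v
    unfolding ex_sink[OF less_imp_le[OF that]] using w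
    by (intro sum.cong refl) (auto simp: elapsed_def w_def len_def)
  then have "flow_value D b \<tau> T g = (\<Sum>v\<in>{v \<in> verts D. b v < 0}. \<Sum>p\<in>{p \<in> P. snk p = v}. x p * w p)"
    by (simp add: flow_value_def)
  also have "\<dots> = (\<Sum>p\<in>P. x p * w p)"
    using fin snk by (intro sum.group) auto
  finally show "flow_value D b \<tau> T g = (\<Sum>p\<in>P. x p * w p)" .
qed

text \<open>This bounds an arc's contribution to a moving cut. The upper limit \<open>b\<close> may
  be negative, as it is a cut time minus a transit time; for \<open>b \<le> a\<close> nonnegativity
  of \<open>h\<close> suffices.\<close>

lemma integral_Ico_diff_le:
  fixes h :: "real \<Rightarrow> real"
  assumes int: "set_integrable lebesgue {0..<T} h"
    and h: "\<And>\<xi>. \<xi> \<in> {0..<T} \<Longrightarrow> 0 \<le> h \<xi> \<and> h \<xi> \<le> c"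
    and a: "0 \<le> a" "a \<le> T" and b: "b \<le> T"
  shows "(LINT \<xi>:{0..<b}|lebesgue. h \<xi>) - (LINT \<xi>:{0..<a}|lebesgue. h \<xi>) \<le> max 0 (b - a) * c"
proof -
  have sub: "set_integrable lebesgue A h" if "A \<subseteq> {0..<T}" "A \<in> sets lebesgue" for A
    using set_integrable_subset[OF int] that by blast
  show ?thesis
  proof (cases "b \<le> a")
    case True
    have "(LINT \<xi>:{0..<b}|lebesgue. h \<xi>) \<le> (LINT \<xi>:{0..<a}|lebesgue. h \<xi>)"
      unfolding set_lebesgue_integral_def
    proof (rule Bochner_Integration.integral_mono)
      show "integrable lebesgue (\<lambda>x. indicator {0..<b} x *\<^sub>R h x)"
        "integrable lebesgue (\<lambda>x. indicator {0..<a} x *\<^sub>R h x)"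
        using sub[of "{0..<b}"] sub[of "{0..<a}"] a b by (auto simp: set_integrable_def)
    qed (use h a True in \<open>auto simp: indicator_def\<close>)
    then show ?thesis using True by simp
  next
    case False
    have "(LINT \<xi>:{0..<a} \<union> {a..<b}|lebesgue. h \<xi>) =
        (LINT \<xi>:{0..<a}|lebesgue. h \<xi>) + (LINT \<xi>:{a..<b}|lebesgue. h \<xi>)"
      using a b by (intro set_integral_Un sub) auto
    moreover have "{0..<a} \<union> {a..<b} = {0..<b}" using False a by auto
    moreover have "(LINT \<xi>:{a..<b}|lebesgue. h \<xi>) \<le> (LINT \<xi>:{a..<b}|lebesgue. c)"
    proof (rule set_integral_mono)
      show "set_integrable lebesgue {a..<b} (\<lambda>_. c)"
        using integrable_indicator_Ico[of a b] by (simp add: set_integrable_def)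
    qed (use h a b in \<open>auto intro!: sub\<close>)
    moreover have "(LINT \<xi>:{a..<b}|lebesgue. c) = (b - a) * c"
      using False by (simp add: set_lebesgue_integral_def)
    ultimately show ?thesis using False by simp
  qed
qed

section \<open>The moving cut\<close>

context undirected_network_over_time begin

abbreviation "D0 \<equiv> bidirected V E ends"

lemma arcs_bidirected: "arcs D0 = {(e, v, w). e \<in> E \<and> ends e = {v, w}}"
  by (simp add: bidirected_def)

lemma bidirected_verts: "verts D0 = V"
  by (simp add: bidirected_def)

lemma bidirected_arc_ends:
  assumes "(e, v, w) \<in> arcs D0"
  shows "e \<in> E" "ends e = {v, w}" "v \<in> V" "w \<in> V" "v \<noteq> w"
  using assms ends_subset[of e] card_ends[of e] by (auto simp: arcs_bidirected)

sublocale bidir: fin_digraph D0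
proof
  fix a assume "a \<in> arcs D0"
  then show "tail D0 a \<in> verts D0" "head D0 a \<in> verts D0"
    using bidirected_arc_ends(3,4) by (cases a; force simp: bidirected_def)+
next
  show "finite (verts D0)" by (simp add: bidirected_def finite_nodes)
  have "arcs D0 \<subseteq> E \<times> V \<times> V" using bidirected_arc_ends by auto
  then show "finite (arcs D0)" using finite_nodes finite_edges by (auto intro: finite_subset)
qed

text \<open>The node \<open>v\<close> joins the cut at time \<open>d v\<close>; the edge \<open>e\<close> can carry flow across the cut for at most
  \<open>l e\<close> time units, in one of its two directions.\<close>

lemma moving_cut_bound:
  assumes f: "undirected_flow_over_time V E ends u b \<tau> T f"
    and l: "\<And>e. e \<in> E \<Longrightarrow> 0 \<le> l e"
    and d: "\<And>v. v \<in> V \<Longrightarrow> 0 \<le> d v \<and> d v \<le> T"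
    and tri: "\<And>e v w. (e, v, w) \<in> arcs D0 \<Longrightarrow> d w \<le> d v + \<tau> e + l e"
  shows "(\<Sum>v\<in>V. excess D0 (\<lambda>(e, v, w). \<tau> e) f v (d v)) \<le> (\<Sum>e\<in>E. l e * u e)"
proof -
  \<comment> \<open>The net contribution of an arc: flow that has left it when its head joins the
    cut, minus flow that has entered it when its tail joins.\<close>
  define h where "h = (\<lambda>(e, v, w). (LINT \<xi>:{0..<d w - \<tau> e}|lebesgue. f (e, v, w) \<xi>) -
    (LINT \<xi>:{0..<d v}|lebesgue. f (e, v, w) \<xi>))"
  have in_sum: "(\<Sum>v\<in>V. \<Sum>a\<in>in_arcs D0 v. H v a) = (\<Sum>a\<in>arcs D0. H (head D0 a) a)" for H :: "'v \<Rightarrow> _ \<Rightarrow> real"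
  proof -
    have "(\<Sum>v\<in>V. \<Sum>a\<in>in_arcs D0 v. H v a) = (\<Sum>v\<in>V. \<Sum>a\<in>{a \<in> arcs D0. head D0 a = v}. H (head D0 a) a)"
      by (intro sum.cong) (auto simp: in_arcs_def)
    also have "\<dots> = (\<Sum>a\<in>arcs D0. H (head D0 a) a)"
      using finite_nodes bidir.head_in_verts bidir.finite_arcs
      by (intro sum.group) (auto simp: bidirected_verts)
    finally show ?thesis .
  qed
  have out_sum: "(\<Sum>v\<in>V. \<Sum>a\<in>out_arcs D0 v. H v a) = (\<Sum>a\<in>arcs D0. H (tail D0 a) a)" for H :: "'v \<Rightarrow> _ \<Rightarrow> real"
  proof -
    have "(\<Sum>v\<in>V. \<Sum>a\<in>out_arcs D0 v. H v a) = (\<Sum>v\<in>V. \<Sum>a\<in>{a \<in> arcs D0. tail D0 a = v}. H (tail D0 a) a)"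
      by (intro sum.cong) (auto simp: out_arcs_def)
    also have "\<dots> = (\<Sum>a\<in>arcs D0. H (tail D0 a) a)"
      using finite_nodes bidir.tail_in_verts bidir.finite_arcs
      by (intro sum.group) (auto simp: bidirected_verts)
    finally show ?thesis .
  qed
  have "(\<Sum>v\<in>V. excess D0 (\<lambda>(e, v, w). \<tau> e) f v (d v)) = (\<Sum>a\<in>arcs D0. h a)"
    unfolding excess_def sum_subtractf in_sum out_sum
    unfolding sum_subtractf[symmetric]
    by (intro sum.cong) (auto simp: h_def bidirected_def)
  also have "\<dots> = (\<Sum>e\<in>E. \<Sum>a\<in>{a \<in> arcs D0. fst a = e}. h a)"
    using finite_edges bidir.finite_arcs
    by (intro sum.group[symmetric]) (auto dest: bidirected_arc_ends(1))
  also have "\<dots> \<le> (\<Sum>e\<in>E. l e * u e)"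
  proof (rule sum_mono)
    fix e assume e: "e \<in> E"
    obtain v w where vw: "ends e = {v, w}" "v \<noteq> w"
      using card_ends[OF e] by (auto simp: card_2_iff)
    have A: "{a \<in> arcs D0. fst a = e} = {(e, v, w), (e, w, v)}"
      using e vw by (auto simp: arcs_bidirected doubleton_eq_iff)
    have arc: "(e, v, w) \<in> arcs D0" "(e, w, v) \<in> arcs D0" using A by auto
    note cons = f[unfolded undirected_flow_over_time_def conserving_flow_over_time_def]
    have nn: "0 \<le> f (e, v, w) \<xi>" "0 \<le> f (e, w, v) \<xi>" if "\<xi> \<in> {0..<T}" for \<xi>
      using cons arc that by blast+
    have share: "f (e, v, w) \<xi> + f (e, w, v) \<xi> \<le> u e" if "\<xi> \<in> {0..<T}" for \<xi>
      using f e vw(1) that by (simp add: undirected_flow_over_time_def)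
    have V: "v \<in> V" "w \<in> V" using bidirected_arc_ends[OF arc(1)] by auto
    have \<tau>: "0 \<le> \<tau> e" using transit_nonneg[OF e] .
    have "h (e, v, w) \<le> max 0 (d w - \<tau> e - d v) * u e"
      unfolding h_def prod.case
    proof (rule integral_Ico_diff_le)
      show "set_integrable lebesgue {0..<T} (f (e, v, w))" using cons arc by blast
      show "0 \<le> f (e, v, w) \<xi> \<and> f (e, v, w) \<xi> \<le> u e" if "\<xi> \<in> {0..<T}" for \<xi>
        using nn[OF that] share[OF that] by linarith
    qed (use d[OF V(1)] d[OF V(2)] \<tau> in auto)
    moreover have "h (e, w, v) \<le> max 0 (d v - \<tau> e - d w) * u e"
      unfolding h_def prod.case
    proof (rule integral_Ico_diff_le)
      show "set_integrable lebesgue {0..<T} (f (e, w, v))" using cons arc by blast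
      show "0 \<le> f (e, w, v) \<xi> \<and> f (e, w, v) \<xi> \<le> u e" if "\<xi> \<in> {0..<T}" for \<xi>
        using nn[OF that] share[OF that] by linarith
    qed (use d[OF V(1)] d[OF V(2)] \<tau> in auto)
    \<comment> \<open>The two differences add up to \<open>- 2 * \<tau> e\<close>, so at most one is
      positive, and each is at most \<open>l e\<close>.\<close>
    moreover have "(max 0 (d w - \<tau> e - d v) + max 0 (d v - \<tau> e - d w)) * u e \<le> l e * u e"
      using tri[OF arc(1)] tri[OF arc(2)] \<tau> l[OF e] capacity_nonneg[OF e]
      by (intro mult_right_mono) auto
    ultimately show "(\<Sum>a\<in>{a \<in> arcs D0. fst a = e}. h a) \<le> l e * u e"
      unfolding A using vw(2) by (simp add: distrib_right)
  qed
  finally show ?thesis .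
qed

end

section \<open>Costs of walks and paths\<close>

lemma sum_list_map_eq_sum_count_real:
  fixes c :: "'e \<Rightarrow> real"
  assumes "finite E" "set q \<subseteq> E"
  shows "sum_list (map c q) = (\<Sum>e\<in>E. real (count_list q e) * c e)"
  using assms(2)
proof (induction q)
  case (Cons a q)
  have "(\<Sum>e\<in>E. real (count_list (a # q) e) * c e) =
      (\<Sum>e\<in>E. (if e = a then c e else 0) + real (count_list q e) * c e)"
    by (intro sum.cong) (auto simp: algebra_simps)
  also have "\<dots> = c a + (\<Sum>e\<in>E. real (count_list q e) * c e)"
    using assms(1) Cons.prems by (simp add: sum.distrib)
  finally show ?case using Cons by simp
qed simp

text \<open>Each arc of the shortcut path occurs there once and in the walk at least once, so with
  nonnegative costs shortcutting never costs more.\<close>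

lemma (in wf_digraph) apath_cost_le_awalk_cost:
  assumes "awalk y p z" and "\<And>a. a \<in> arcs G \<Longrightarrow> 0 \<le> c a"
  shows "\<exists>q. apath y q z \<and> awalk_cost c q \<le> awalk_cost c p"
proof -
  let ?q = "awalk_to_apath p"
  have q: "apath y ?q z" using apath_awalk_to_apath[OF assms(1)] .
  then have dist: "distinct ?q"
    using distinct_verts_imp_distinct by (auto simp: apath_def)
  have sub: "set ?q \<subseteq> set p" "set p \<subseteq> arcs G"
    using awalk_to_apath_subset[OF assms(1)] assms(1) by auto
  have "awalk_cost c ?q = sum c (set ?q)"
    using dist by (simp add: awalk_cost_def sum_list_distinct_conv_sum_set)
  also have "\<dots> = (\<Sum>a\<in>set ?q. 1 * c a)" by simp
  also have "\<dots> \<le> (\<Sum>a\<in>set ?q. real (count_list p a) * c a)"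
    using sub assms(2) by (intro sum_mono mult_right_mono) (auto simp: Suc_le_eq count_list_0_iff intro!: gr0I)
  also have "\<dots> \<le> (\<Sum>a\<in>set p. real (count_list p a) * c a)"
    using sub assms(2) by (intro sum_mono2) auto
  also have "\<dots> = awalk_cost c p"
    unfolding awalk_cost_def by (rule sum_list_map_eq_sum_count_real[symmetric]) auto
  finally show ?thesis using q by blast
qed

section \<open>Orientation from an equilibrium\<close>

context undirected_network_over_time begin

text \<open>Simple paths keep the packing finite; shortcutting extends the price inequalities to all
  walks.\<close>

definition terminal_paths :: "('v \<times> ('e \<times> 'v \<times> 'v) list \<times> 'v) set" where
  "terminal_paths = {(s, p, t). s \<in> V \<and> 0 < b s \<and> t \<in> V \<and> b t < 0 \<and> bidir.apath s p t}"

definition edge_count :: "'v \<times> ('e \<times> 'v \<times> 'v) list \<times> 'v \<Rightarrow> 'e \<Rightarrow> nat" where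
  "edge_count = (\<lambda>(s, p, t). count_list (map fst p))"

lemma terminal_pathsD:
  assumes "(s, p, t) \<in> terminal_paths"
  shows "s \<in> V" "0 < b s" "t \<in> V" "b t < 0" "bidir.awalk s p t" "set p \<subseteq> arcs D0" "set (map fst p) \<subseteq> E"
proof -
  show "s \<in> V" "0 < b s" "t \<in> V" "b t < 0" and p: "bidir.awalk s p t"
    using assms by (auto simp: terminal_paths_def bidir.apath_def)
  then show sub: "set p \<subseteq> arcs D0" by blast
  show "set (map fst p) \<subseteq> E" using sub by (auto dest!: subsetD dest: bidirected_arc_ends(1))
qed

interpretation packing: path_packing terminal_paths E V edge_count fst "snd \<circ> snd" u "\<lambda>v. \<bar>b v\<bar>"
proof
  show "finite terminal_paths"
    using bidir.apaths_finite_triple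
    by (rule finite_subset[rotated]) (auto simp: terminal_paths_def)
next
  fix P assume P: "P \<in> terminal_paths"
  obtain s p t where P': "P = (s, p, t)" by (cases P)
  note D = terminal_pathsD[OF P[unfolded P']]
  show "fst P \<in> V" "(snd \<circ> snd) P \<in> V" using D by (auto simp: P')
  \<comment> \<open>The ends differ because \<open>b\<close> has opposite signs there.\<close>
  have "p \<noteq> []" using D by (auto simp: bidir.awalk_Nil_iff)
  then have e: "fst (hd p) \<in> set (map fst p)" by simp
  then have "0 < edge_count P (fst (hd p))"
    by (simp only: edge_count_def P' prod.case neq0_conv[symmetric] count_list_0_iff) simp
  then show "\<exists>e\<in>E. 0 < edge_count P e" using e D(7) by blast
qed (use finite_nodes finite_edges capacity_nonneg in auto)

definition path_duration :: "'v \<times> ('e \<times> 'v \<times> 'v) list \<times> 'v \<Rightarrow> real" where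
  "path_duration = (\<lambda>(s, p, t). T - sum_list (map \<tau> (map fst p)))"

text \<open>Translates between path prices and walk costs: \<open>w p \<le> price l m p\<close>
  becomes \<open>T \<le> m s + m t\<close> plus the cost of the path with respect to
  \<open>\<tau> + \<epsilon> + l\<close>.\<close>

lemma path_cost:
  assumes "(s, p, t) \<in> terminal_paths"
  shows "T - (path_duration (s, p, t) - \<epsilon> * (\<Sum>e\<in>E. real (edge_count (s, p, t) e))) +
      (\<Sum>e\<in>E. real (edge_count (s, p, t) e) * l e) =
    bidir.awalk_cost (\<lambda>a. \<tau> (fst a) + \<epsilon> + l (fst a)) p"
proof -
  note E = terminal_pathsD(7)[OF assms]
  have "T - (path_duration (s, p, t) - \<epsilon> * (\<Sum>e\<in>E. real (edge_count (s, p, t) e))) +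
      (\<Sum>e\<in>E. real (edge_count (s, p, t) e) * l e) =
      (\<Sum>e\<in>E. real (count_list (map fst p) e) * (\<tau> e + \<epsilon> + l e))"
    unfolding path_duration_def edge_count_def prod.case sum_list_map_eq_sum_count_real[OF finite_edges E]
    by (simp add: algebra_simps sum.distrib sum_distrib_left)
  also have "\<dots> = bidir.awalk_cost (\<lambda>a. \<tau> (fst a) + \<epsilon> + l (fst a)) p"
    unfolding sum_list_map_eq_sum_count_real[OF finite_edges E, symmetric] bidir.awalk_cost_def
    by (simp add: o_def)
  finally show ?thesis .
qed

text \<open>Walks have to be covered because exchanging path ends, or following a walk for the cut
  distances, need not give simple paths.\<close>

lemma equilibrium_walk_cost:
  assumes eq: "packing.equilibrium (\<lambda>P. path_duration P - \<epsilon> * (\<Sum>e\<in>E. real (edge_count P e))) x l m"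
    and \<epsilon>: "0 \<le> \<epsilon>" and s: "s \<in> V" "0 < b s" and t: "t \<in> V" "b t < 0"
    and p: "bidir.awalk s p t"
  shows "T \<le> m s + m t + bidir.awalk_cost (\<lambda>a. \<tau> (fst a) + \<epsilon> + l (fst a)) p"
proof -
  let ?c = "\<lambda>a :: 'e \<times> 'v \<times> 'v. \<tau> (fst a) + \<epsilon> + l (fst a)"
  have "0 \<le> ?c a" if "a \<in> arcs D0" for a
  proof -
    have "fst a \<in> E" using that by (cases a) (auto dest: bidirected_arc_ends(1))
    then show ?thesis using eq \<epsilon> transit_nonneg by (auto simp: packing.equilibrium_def)
  qed
  then obtain q where q: "bidir.apath s q t" "bidir.awalk_cost ?c q \<le> bidir.awalk_cost ?c p"
    using bidir.apath_cost_le_awalk_cost[OF p, of ?c] by blast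
  have Q: "(s, q, t) \<in> terminal_paths" using q s t by (simp add: terminal_paths_def)
  then have "path_duration (s, q, t) - \<epsilon> * (\<Sum>e\<in>E. real (edge_count (s, q, t) e)) \<le>
      m s + m t + (\<Sum>e\<in>E. real (edge_count (s, q, t) e) * l e)"
    using eq unfolding packing.equilibrium_def packing.price_def by fastforce
  then show ?thesis using path_cost[OF Q, of \<epsilon> l] q(2) by simp
qed

lemma equilibrium_path_cost:
  assumes eq: "packing.equilibrium (\<lambda>P. path_duration P - \<epsilon> * (\<Sum>e\<in>E. real (edge_count P e))) x l m"
    and P: "(s, p, t) \<in> terminal_paths" "0 < x (s, p, t)"
  shows "T = m s + m t + bidir.awalk_cost (\<lambda>a. \<tau> (fst a) + \<epsilon> + l (fst a)) p"
proof -
  have "path_duration (s, p, t) - \<epsilon> * (\<Sum>e\<in>E. real (edge_count (s, p, t) e)) =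
      m s + m t + (\<Sum>e\<in>E. real (edge_count (s, p, t) e) * l e)"
    using eq P unfolding packing.equilibrium_def packing.price_def by fastforce
  then show ?thesis using path_cost[OF P(1), of \<epsilon> l] by simp
qed

text \<open>Exchange the parts of the two paths behind the edge \<open>e\<close>: both new walks avoid \<open>e\<close>, which saves
  \<open>2 * (\<tau> e + \<epsilon> + l e) > 0\<close> in total, while the terminal prices are the same.\<close>

lemma no_opposite_arcs:
  assumes eq: "packing.equilibrium (\<lambda>P. path_duration P - \<epsilon> * (\<Sum>e\<in>E. real (edge_count P e))) x l m"
    and \<epsilon>: "0 < \<epsilon>"
    and P: "(s, p, t) \<in> terminal_paths" "0 < x (s, p, t)"
    and P': "(s', p', t') \<in> terminal_paths" "0 < x (s', p', t')"
  shows "\<not> ((e, v, w) \<in> set p \<and> (e, w, v) \<in> set p')"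
proof (intro notI, elim conjE)
  assume "(e, v, w) \<in> set p" "(e, w, v) \<in> set p'"
  then obtain p1 p2 p1' p2' where p: "p = p1 @ (e, v, w) # p2" "p' = p1' @ (e, w, v) # p2'"
    by (meson split_list)
  note D = terminal_pathsD[OF P(1)] and D' = terminal_pathsD[OF P'(1)]
  let ?C = "bidir.awalk_cost (\<lambda>a. \<tau> (fst a) + \<epsilon> + l (fst a))"
  have hd_tl: "tail D0 (e, v, w) = v" "head D0 (e, v, w) = w" for v w
    by (auto simp: bidirected_def)
  have w1: "bidir.awalk s p1 v" "bidir.awalk w p2 t" and w2: "bidir.awalk s' p1' w" "bidir.awalk v p2' t'"
    using D(5) D'(5) by (auto simp: p bidir.awalk_append_iff bidir.awalk_Cons_iff hd_tl)
  have "T \<le> m s + m t' + ?C (p1 @ p2')"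
    using D D' w1 w2 \<epsilon> by (intro equilibrium_walk_cost[OF eq] bidir.awalk_appendI) auto
  moreover have "T \<le> m s' + m t + ?C (p1' @ p2)"
    using D D' w1 w2 \<epsilon> by (intro equilibrium_walk_cost[OF eq] bidir.awalk_appendI) auto
  moreover have "e \<in> E" using D(7) by (simp add: p)
  then have "0 \<le> \<tau> e" "0 \<le> l e" using eq transit_nonneg by (auto simp: packing.equilibrium_def)
  ultimately show False
    using equilibrium_path_cost[OF eq P] equilibrium_path_cost[OF eq P'] \<epsilon>
    by (simp add: p)
qed

text \<open>Each edge gets the only direction in which a path of positive rate traverses it, or an
  arbitrary one if there is none. Forgetting directions then turns the used paths into walks of
  \<open>D\<close>, to which the temporally repeated flow applies.\<close>

lemma oriented_flow:
  assumes eq: "packing.equilibrium path_duration x l m"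
    and opp: "\<And>s p t s' p' t' e v w. (s, p, t) \<in> terminal_paths \<Longrightarrow> 0 < x (s, p, t) \<Longrightarrow>
      (s', p', t') \<in> terminal_paths \<Longrightarrow> 0 < x (s', p', t') \<Longrightarrow> \<not> ((e, v, w) \<in> set p \<and> (e, w, v) \<in> set p')"
  obtains D g where "orientation V E ends D" "flow_over_time D u b \<tau> T g"
    "flow_value D b \<tau> T g = (\<Sum>P\<in>terminal_paths. x P * path_duration P)"
proof -
  define used where "used a \<longleftrightarrow> (\<exists>s p t. (s, p, t) \<in> terminal_paths \<and> 0 < x (s, p, t) \<and> a \<in> set p)" for a
  have used: "a \<in> arcs D0" "used (e, v, w) \<Longrightarrow> \<not> used (e, w, v)" if "used a" for a e v w
    using that opp terminal_pathsD(6) unfolding used_def by blast+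
  have "\<exists>v w. ends e = {v, w} \<and> (\<forall>v' w'. used (e, v', w') \<longrightarrow> v' = v \<and> w' = w)" if e: "e \<in> E" for e
  proof (cases "\<exists>v w. used (e, v, w)")
    case True
    then obtain v w where vw: "used (e, v, w)" by blast
    have "v' = v \<and> w' = w" if "used (e, v', w')" for v' w'
      using used(1)[OF vw] used(1)[OF that] used(2)[OF vw vw] that
      by (auto simp: arcs_bidirected doubleton_eq_iff)
    then show ?thesis using used(1)[OF vw] by (auto simp: arcs_bidirected)
  next
    case False
    then show ?thesis using card_ends[OF e] by (auto simp: card_2_iff)
  qed
  then obtain tl hd where th: "\<And>e. e \<in> E \<Longrightarrow> ends e = {tl e, hd e}"
    "\<And>e v w. e \<in> E \<Longrightarrow> used (e, v, w) \<Longrightarrow> v = tl e \<and> w = hd e" by metis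
  define D where "D = \<lparr>verts = V, arcs = E, tail = tl, head = hd\<rparr>"
  have cas: "pre_digraph.cas D s (map fst p) t"
    if "bidir.cas s p t" "\<forall>a\<in>set p. used a" "set p \<subseteq> arcs D0" for s p t
    using that
  proof (induction p arbitrary: s)
    case (Cons a p)
    obtain e v w where a: "a = (e, v, w)" by (cases a)
    have "v = tl e \<and> w = hd e" using Cons.prems a th(2) bidirected_arc_ends(1) by auto
    then show ?case using Cons a by (auto simp: pre_digraph.cas.simps D_def bidirected_def)
  qed (simp add: pre_digraph.cas.simps)
  let ?P = "{P \<in> terminal_paths. 0 < x P}" and ?walk = "\<lambda>P. map fst (fst (snd P))"
  have dur: "path_duration = (\<lambda>P. T - sum_list (map \<tau> (?walk P)))"
    by (auto simp: path_duration_def)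
  \<comment> \<open>Restricting to positive rates changes no sum but makes all durations
    nonnegative.\<close>
  have supp: "(\<Sum>P\<in>{P \<in> ?P. Q P}. x P * path_duration P) = (\<Sum>P\<in>{P \<in> terminal_paths. Q P}. x P * path_duration P)" for Q
    using packing.finite_P eq
    by (intro sum.mono_neutral_left) (auto simp: packing.equilibrium_def order.order_iff_strict)
  have dpos: "0 \<le> path_duration P" if "P \<in> ?P" for P
    using packing.equilibrium_work_nonneg[OF eq, of P] that by (auto simp: zero_le_mult_iff)
  have count: "count_list (?walk P) e = edge_count P e" for P e
    by (simp add: edge_count_def split: prod.split)
  have mem: "fst P \<in> V \<and> 0 < b (fst P)" "snd (snd P) \<in> V \<and> b (snd (snd P)) < 0"
    "pre_digraph.cas D (fst P) (?walk P) (snd (snd P)) \<and> set (?walk P) \<subseteq> E" if "P \<in> ?P" for P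
  proof -
    obtain s p t where P: "P = (s, p, t)" by (cases P)
    then have P': "(s, p, t) \<in> terminal_paths" "\<forall>a\<in>set p. used a"
      using that by (auto simp: used_def)
    note D = terminal_pathsD[OF P'(1)]
    show "fst P \<in> V \<and> 0 < b (fst P)" "snd (snd P) \<in> V \<and> b (snd (snd P)) < 0"
      "pre_digraph.cas D (fst P) (?walk P) (snd (snd P)) \<and> set (?walk P) \<subseteq> E"
      using D P'(2) cas[of s p t] by (auto simp: P bidir.awalk_def)
  qed
  have cap: "(\<Sum>P\<in>?P. x P * count_list (?walk P) e) \<le> u e" if e: "e \<in> E" for e
  proof -
    have "(\<Sum>P\<in>?P. x P * count_list (?walk P) e) \<le> packing.load x e"
      unfolding packing.load_def count using packing.finite_P eq
      by (intro ord_eq_le_trans[OF _ sum_mono2]) (auto simp: packing.equilibrium_def mult.commute)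
    also have "\<dots> \<le> u e" using eq e by (simp add: packing.equilibrium_def)
    finally show ?thesis .
  qed
  have out: "(\<Sum>P\<in>{P \<in> ?P. fst P = v}. x P * path_duration P) \<le> b v" if v: "v \<in> V" "0 < b v" for v
  proof -
    \<comment> \<open>No path ends at a source, so \<open>amount\<close> counts just the paths
      starting there.\<close>
    have "(\<Sum>P\<in>{P \<in> ?P. fst P = v}. x P * path_duration P) = packing.amount path_duration x v"
      unfolding packing.amount_def supp using terminal_pathsD(4) v(2)
      by (intro sum.cong) fastforce+
    also have "\<dots> \<le> b v" using eq v by (force simp: packing.equilibrium_def)
    finally show ?thesis .
  qed
  have "in": "(\<Sum>P\<in>{P \<in> ?P. snd (snd P) = v}. x P * path_duration P) \<le> - b v" if v: "v \<in> V" "b v < 0" for v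
  proof -
    have "(\<Sum>P\<in>{P \<in> ?P. snd (snd P) = v}. x P * path_duration P) = packing.amount path_duration x v"
      unfolding packing.amount_def supp using terminal_pathsD(2) v(2)
      by (intro sum.cong) fastforce+
    also have "\<dots> \<le> - b v" using eq v by (force simp: packing.equilibrium_def)
    finally show ?thesis .
  qed
  have flow: "flow_over_time D u b \<tau> T (\<lambda>a \<xi>. \<Sum>P\<in>?P. x P * walk_rate \<tau> (path_duration P) 0 (?walk P) a \<xi>) \<and>
    flow_value D b \<tau> T (\<lambda>a \<xi>. \<Sum>P\<in>?P. x P * walk_rate \<tau> (path_duration P) 0 (?walk P) a \<xi>) =
      (\<Sum>P\<in>?P. x P * path_duration P)"
    unfolding dur
    by (intro conjI temporally_repeated_flow[where src = fst and snk = "\<lambda>P. snd (snd P)"])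
      (use mem cap out[unfolded dur] "in"[unfolded dur] dpos[unfolded dur]
        finite_nodes finite_edges transit_nonneg packing.finite_P in \<open>auto simp: D_def\<close>)
  have "orientation V E ends D" using th(1) by (auto simp: orientation_def D_def)
  from that[OF this conjunct1[OF flow] trans[OF conjunct2[OF flow]]] show thesis
    using supp[of "\<lambda>_. True"] by simp
qed

section \<open>Comparison with the undirected flow\<close>

lemma undirected_value_le:
  assumes eq: "packing.equilibrium path_duration x l m"
    and f: "undirected_flow_over_time V E ends u b \<tau> T f"
    and val: "undirected_flow_value V E ends b \<tau> T f = total_supply V b"
  shows "total_supply V b / 3 \<le> (\<Sum>P\<in>terminal_paths. x P * path_duration P)" (is "_ \<le> ?val")
proof -
  define S where "S = {v \<in> V. 0 < b v}"
  define K where "K = {v \<in> V. b v < 0}"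
  note l = eq[unfolded packing.equilibrium_def, THEN conjunct2, THEN conjunct1, rule_format, THEN conjunct1]
    and m = eq[unfolded packing.equilibrium_def, THEN conjunct2, THEN conjunct2, rule_format, THEN conjunct1]
  note cons = f[unfolded undirected_flow_over_time_def conserving_flow_over_time_def, THEN conjunct1, unfolded bidirected_verts]
  let ?c = "\<lambda>a :: 'e \<times> 'v \<times> 'v. \<tau> (fst a) + l (fst a)"
  let ?ex = "excess D0 (\<lambda>(e, v, w). \<tau> e) f"
  have fin: "finite S" "finite K" using finite_nodes by (auto simp: S_def K_def)
  have c: "0 \<le> ?c a" if "a \<in> arcs D0" for a
    using that l transit_nonneg by (cases a) (auto dest: bidirected_arc_ends(1))
  \<comment> \<open>Including \<open>T\<close> keeps the cut times within the horizon and covers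
    nodes that no source of price 0 reaches. Taking walks makes \<open>tri\<close> a matter of
    appending one arc.\<close>
  define W where "W v = insert T {bidir.awalk_cost ?c p | s p. s \<in> S \<and> m s = 0 \<and> bidir.awalk s p v}" for v
  define d where "d v = Inf (W v)" for v
  have W0: "0 \<le> y" if "y \<in> W v" for y v
    using that bidir.pos_cost_pos_awalk_cost[of _ _ _ ?c] c horizon_nonneg by (auto simp: W_def)
  have bdd: "bdd_below (W v)" for v using W0 by (rule bdd_belowI)
  have TW: "T \<in> W v" for v by (simp add: W_def)
  have d: "0 \<le> d v \<and> d v \<le> T" for v
    unfolding d_def using W0[of _ v] TW[of v] bdd[of v] by (blast intro: cInf_greatest cInf_lower)
  have tri: "d w \<le> d v + \<tau> e + l e" if a: "(e, v, w) \<in> arcs D0" for e v w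
  proof -
    have "d w - (\<tau> e + l e) \<le> y" if y: "y \<in> W v" for y
    proof (cases "y = T")
      case True
      then show ?thesis using d[of w] c[OF a] by simp
    next
      case False
      then obtain s p where p: "y = bidir.awalk_cost ?c p" "s \<in> S" "m s = 0" "bidir.awalk s p v"
        using y by (auto simp: W_def)
      have "bidir.awalk v [(e, v, w)] w"
        using bidir.arc_implies_awalk[OF a] by (simp add: bidirected_def)
      then have "bidir.awalk s (p @ [(e, v, w)]) w" using p(4) by (rule bidir.awalk_appendI[rotated])
      then have "bidir.awalk_cost ?c (p @ [(e, v, w)]) \<in> W w" using p(2,3) unfolding W_def by blast
      then have "d w \<le> bidir.awalk_cost ?c (p @ [(e, v, w)])"
        unfolding d_def using bdd by (rule cInf_lower)
      then show ?thesis using p(1) by simp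
    qed
    then have "d w - (\<tau> e + l e) \<le> d v"
      unfolding d_def[of v] using TW by (intro cInf_greatest) auto
    then show ?thesis by simp
  qed
  have d_source: "d s = 0" if "s \<in> S" "m s = 0" for s
  proof -
    have "bidir.awalk s [] s" using that by (simp add: bidir.awalk_Nil_iff bidirected_verts S_def)
    then have "bidir.awalk_cost ?c [] \<in> W s" using that unfolding W_def by blast
    then have "d s \<le> 0" unfolding d_def using bdd by (simp add: cInf_lower)
    then show ?thesis using d[of s] by simp
  qed
  \<comment> \<open>With both terminal prices 0, the equilibrium makes every such walk cost at least
    \<open>T\<close>.\<close>
  have d_sink: "d t = T" if t: "t \<in> K" "m t = 0" for t
  proof -
    have "T \<le> y" if "y \<in> W t" for y
    proof (cases "y = T")
      case False
      then obtain s p where p: "y = bidir.awalk_cost ?c p" "s \<in> S" "m s = 0" "bidir.awalk s p t"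
        using \<open>y \<in> W t\<close> by (auto simp: W_def)
      show ?thesis
        using equilibrium_walk_cost[of 0 x l m s t p] eq t p by (simp add: S_def K_def)
    qed simp
    then have "T \<le> d t" unfolding d_def using TW by (intro cInf_greatest) auto
    then show ?thesis using d[of t] by simp
  qed
  have B_S: "total_supply V b = (\<Sum>v\<in>S. b v)" by (simp add: total_supply_def S_def)
  have "(\<Sum>v\<in>V. b v) = (\<Sum>v\<in>S \<union> K. b v)"
    using finite_nodes by (intro sum.mono_neutral_right) (auto simp: S_def K_def)
  also have "\<dots> = (\<Sum>v\<in>S. b v) + (\<Sum>v\<in>K. b v)"
    using fin by (intro sum.union_disjoint) (auto simp: S_def K_def)
  finally have B_K: "total_supply V b = (\<Sum>v\<in>K. - b v)"
    using balances_sum B_S by (simp add: sum_negf)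
  \<comment> \<open>The value equals the total demand and no sink receives more than its demand, so
    every sink receives all of it.\<close>
  have ex_K: "?ex t T = - b t" if "t \<in> K" for t
  proof (rule ccontr)
    assume ne: "\<not> ?thesis"
    have le: "?ex t T \<le> - b t" if "t \<in> K" for t
      using cons that horizon_nonneg by (auto simp: K_def)
    have "(\<Sum>t\<in>K. ?ex t T) < (\<Sum>t\<in>K. - b t)"
      using le ne that fin by (intro sum_strict_mono_ex1) (auto simp: order.order_iff_strict)
    then show False
      using val B_K by (simp add: undirected_flow_value_def flow_value_def K_def bidirected_verts)
  qed
  have ex_0: "?ex v 0 = 0" for v
  proof -
    have "{0..<0 - (case a of (e, v, w) \<Rightarrow> \<tau> e)} = {}" if "a \<in> in_arcs D0 v" for a
      using that transit_nonneg[OF bidirected_arc_ends(1)] by (cases a) (auto simp: in_arcs_def not_less)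
    then have 1: "(\<Sum>a\<in>in_arcs D0 v. LINT \<xi>:{0..<0 - (case a of (e, v, w) \<Rightarrow> \<tau> e)}|lebesgue. f a \<xi>) = 0"
      by (intro sum.neutral ballI) (simp only: set_lebesgue_integral_def, simp)
    have 2: "(\<Sum>a\<in>out_arcs D0 v. LINT \<xi>:{0..<0}|lebesgue. f a \<xi>) = 0"
      by (simp add: set_lebesgue_integral_def)
    show ?thesis unfolding excess_def by (simp only: 1 2 diff_self)
  qed
  have cons_v: "b v = 0 \<Longrightarrow> 0 \<le> ?ex v \<theta>" "0 < b v \<Longrightarrow> - b v \<le> ?ex v \<theta>" "b v < 0 \<Longrightarrow> 0 \<le> ?ex v \<theta>"
    if "v \<in> V" "0 \<le> \<theta>" "\<theta> \<le> T" for v \<theta>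
    using cons that by auto
  \<comment> \<open>A sink of price 0 joins at time \<open>T\<close> with its full demand, a source
    of price 0 at time 0 with excess 0. A source of positive price has excess at least
    \<open>- b v\<close>; all other nodes have nonnegative excess.\<close>
  have low: "(if v \<in> K \<and> m v = 0 then - b v else 0) - (if v \<in> S \<and> 0 < m v then b v else 0) \<le> ?ex v (d v)"
    if v: "v \<in> V" for v
  proof -
    consider "b v = 0" | "0 < b v" "0 < m v" | "0 < b v" "m v = 0" | "b v < 0" "0 < m v" | "b v < 0" "m v = 0"
      using m[OF v] by linarith
    then show ?thesis
    proof cases
      case 3
      then have "d v = 0" using v by (intro d_source) (auto simp: S_def)
      then show ?thesis using 3 ex_0[of v] by (simp add: S_def K_def)
    next
      case 5
      then have "v \<in> K" using v by (simp add: K_def)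
      then show ?thesis using 5 d_sink[of v] ex_K[of v] by (simp add: S_def)
    qed (use v cons_v[OF v, of "d v"] d[of v] in \<open>simp_all add: S_def K_def\<close>)
  qed
  have "(\<Sum>v\<in>{v \<in> K. m v = 0}. - b v) - (\<Sum>v\<in>{v \<in> S. 0 < m v}. b v) =
    (\<Sum>v\<in>V. (if v \<in> K \<and> m v = 0 then - b v else 0) - (if v \<in> S \<and> 0 < m v then b v else 0))"
    unfolding sum_subtractf using finite_nodes
    by (simp add: sum.inter_filter[symmetric] S_def K_def conj_assoc)
  also have "\<dots> \<le> (\<Sum>v\<in>V. ?ex v (d v))" by (intro sum_mono low)
  also have "\<dots> \<le> (\<Sum>e\<in>E. l e * u e)"
    using l d tri by (intro moving_cut_bound[OF f]) auto
  also have "\<dots> \<le> ?val" by (rule packing.edge_prices_le_work[OF eq])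
  finally have "(\<Sum>v\<in>{v \<in> K. m v = 0}. - b v) - (\<Sum>v\<in>{v \<in> S. 0 < m v}. b v) \<le> ?val" .
  moreover have "(\<Sum>v\<in>{v \<in> S. 0 < m v}. b v) \<le> ?val"
  proof -
    have "(\<Sum>v\<in>{v \<in> S. 0 < m v}. \<bar>b v\<bar>) \<le> ?val"
      using terminal_pathsD(4) by (intro packing.terminal_balances_le_work[OF eq]) (fastforce simp: S_def)+
    then show ?thesis by (simp add: S_def)
  qed
  moreover have "(\<Sum>v\<in>{v \<in> K. 0 < m v}. - b v) \<le> ?val"
  proof -
    have "(\<Sum>v\<in>{v \<in> K. 0 < m v}. \<bar>b v\<bar>) \<le> ?val"
      using terminal_pathsD(2) by (intro packing.terminal_balances_le_work[OF eq]) (fastforce simp: K_def)+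
    then show ?thesis by (simp add: K_def)
  qed
  moreover have "(\<Sum>v\<in>K. - b v) = (\<Sum>v\<in>{v \<in> K. m v = 0}. - b v) + (\<Sum>v\<in>{v \<in> K. 0 < m v}. - b v)"
  proof -
    have "K = {v \<in> K. m v = 0} \<union> {v \<in> K. 0 < m v}" using m by (force simp: K_def)
    from arg_cong[OF this, of "sum (\<lambda>v. - b v)"] show ?thesis
      using fin by (subst (asm) sum.union_disjoint) auto
  qed
  \<comment> \<open>Sinks of price 0 demand at most \<open>?val\<close> plus the supply of the
    priced sources, hence at most twice \<open>?val\<close>; the priced sinks demand at most
    \<open>?val\<close> more.\<close>
  ultimately show ?thesis using B_K by linarith
qed

lemma orientation_third:
  assumes "undirected_flow_over_time V E ends u b \<tau> T f"
    and "undirected_flow_value V E ends b \<tau> T f = total_supply V b"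
  shows "\<exists>D. orientation V E ends D \<and>
    (\<exists>g. flow_over_time D u b \<tau> T g \<and> total_supply V b / 3 \<le> flow_value D b \<tau> T g)"
proof -
  \<comment> \<open>The unperturbed equilibrium supplies the rates and the value; the perturbed one
    only excludes opposite arcs, through the inclusion of supports.\<close>
  obtain x l m x' l' m' \<epsilon> where eq: "packing.equilibrium path_duration x l m" and \<epsilon>: "0 < \<epsilon>"
    and eq': "packing.equilibrium (\<lambda>P. path_duration P - \<epsilon> * (\<Sum>e\<in>E. real (edge_count P e))) x' l' m'"
    and supp: "\<And>P. P \<in> terminal_paths \<Longrightarrow> 0 < x P \<Longrightarrow> 0 < x' P"
    by (rule packing.perturbed_equilibrium[of path_duration]) (rule that)
  obtain D g where "orientation V E ends D" "flow_over_time D u b \<tau> T g"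
    "flow_value D b \<tau> T g = (\<Sum>P\<in>terminal_paths. x P * path_duration P)"
      proof (rule oriented_flow[OF eq])
    fix s p t s' p' t' e v w
    assume P: "(s, p, t) \<in> terminal_paths" "0 < x (s, p, t)"
      and P': "(s', p', t') \<in> terminal_paths" "0 < x (s', p', t')"
    show "\<not> ((e, v, w) \<in> set p \<and> (e, w, v) \<in> set p')"
      by (rule no_opposite_arcs[OF eq' \<epsilon> P(1) supp[OF P] P'(1) supp[OF P']])
  qed blast
  moreover from this(3) have "total_supply V b / 3 \<le> flow_value D b \<tau> T g"
    using undirected_value_le[OF eq assms] by (rule ord_le_eq_trans[rotated, OF sym])
  ultimately show ?thesis by blast
qed

end

theorem theorem1:
  fixes V :: "'v set" and E :: "'e set" and ends :: "'e \<Rightarrow> 'v set"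
    and u \<tau> :: "'e \<Rightarrow> real" and b :: "'v \<Rightarrow> real" and T :: real
  assumes "undirected_network_over_time V E ends u b \<tau> T"
    and "\<exists>f. undirected_flow_over_time V E ends u b \<tau> T f \<and>
           undirected_flow_value V E ends b \<tau> T f = total_supply V b"
  shows "\<exists>D. orientation V E ends D \<and>
           (\<exists>g. flow_over_time D u b \<tau> T g \<and>
                total_supply V b / 3 \<le> flow_value D b \<tau> T g)"
  using undirected_network_over_time.orientation_third[OF assms(1)] assms(2) by blast

end
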